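(* For every integer $k\ge1$, the focal submanifolds $M_1$ of OT-FKM type with $(m_1,m_2)=(3,4k)$ are not intrinsically homogeneous; that is, the isometry group of $M_1$, with the metric induced from the unit sphere, does not act transitively on $M_1$.
   Context: OT-FKM type: a symmetric Clifford system on $\mathbb{R}^{2l}$ is a set $\{P_0,\dots,P_m\}$ of symmetric real $2l\times 2l$ matrices with $P_\alpha P_\beta+P_\beta P_\alpha=2\delta_{\alpha\beta}I_{2l}$. Assume $m>0$ and $l-m-1>0$. Put $F(x)=|x|^4-2\sum_{\alpha=0}^m\langle P_\alpha x,x\rangle^2$. Then $f=F|_{S^{2l-1}}$ is an isoparametric function on the unit sphere $S^{2l-1}$ whose regular level sets are isoparametric hypersurfaces with four distinct principal curvatures and multiplicities $(m_1,m_2)=(m,l-m-1)$. The focal submanifold $M_1$ is $M_1=f^{-1}(1)=\{x\in S^{2l-1}:\langle P_0x,x\rangle=\cdots=\langle P_mx,x\rangle=0\}$. The case $(m_1,m_2)=(3,4k)$ means $m=3$ and $l=4k+4$. *)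

theory Defs
  imports "HOL-Analysis.Analysis"
begin

section \<open>Symmetric Clifford systems and the focal submanifold\<close>

definition clifford_system :: "nat \<Rightarrow> (nat \<Rightarrow> real ^ 'n ^ 'n) \<Rightarrow> bool" where
  "clifford_system m P \<longleftrightarrow>
     (\<forall>\<alpha>\<le>m. transpose (P \<alpha>) = P \<alpha>) \<and>
     (\<forall>\<alpha>\<le>m. \<forall>\<beta>\<le>m. P \<alpha> ** P \<beta> + P \<beta> ** P \<alpha> = (if \<alpha> = \<beta> then 2 else 0) *\<^sub>R mat 1)"

text \<open>The space is \<open>\<real>\<^bsup>2l\<^esup>\<close>, with \<open>2l = CARD('n)\<close>. The two inequalities say that both
  multiplicities \<open>m\<close> and \<open>l - m - 1\<close> are positive.\<close>

definition ot_fkm_type :: "nat \<Rightarrow> nat \<Rightarrow> (nat \<Rightarrow> real ^ 'n ^ 'n) \<Rightarrow> bool" where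
  "ot_fkm_type l m P \<longleftrightarrow> CARD('n) = 2 * l \<and> 0 < m \<and> m + 1 < l \<and> clifford_system m P"

definition ot_fkm_multiplicities :: "nat \<Rightarrow> nat \<Rightarrow> nat \<times> nat" where
  "ot_fkm_multiplicities l m = (m, l - m - 1)"

definition ot_fkm_poly :: "nat \<Rightarrow> (nat \<Rightarrow> real ^ 'n ^ 'n) \<Rightarrow> real ^ 'n \<Rightarrow> real" where
  "ot_fkm_poly m P x = norm x ^ 4 - 2 * (\<Sum>\<alpha>\<le>m. ((P \<alpha> *v x) \<bullet> x)\<^sup>2)"

definition focal_M1 :: "nat \<Rightarrow> (nat \<Rightarrow> real ^ 'n ^ 'n) \<Rightarrow> (real ^ 'n) set" where
  "focal_M1 m P = {x \<in> sphere 0 1. ot_fkm_poly m P x = 1}"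

lemma focal_M1_eq:
  "focal_M1 m P = {x \<in> sphere 0 1. \<forall>\<alpha>\<le>m. (P \<alpha> *v x) \<bullet> x = 0}"
  by (auto simp: focal_M1_def ot_fkm_poly_def sum_nonneg_eq_0_iff)

section \<open>Smooth maps and Riemannian isometries of subsets of Euclidean space\<close>

text \<open>These notions are used for open \<open>U\<close>. In finite dimension the Frechet derivative is of class
  \<open>C\<^sup>k\<close> iff its value on each fixed vector is.\<close>

primrec Ck_on :: "nat \<Rightarrow> 'a::euclidean_space set \<Rightarrow> ('a \<Rightarrow> 'b::real_normed_vector) \<Rightarrow> bool" where
  "Ck_on 0 U f \<longleftrightarrow> continuous_on U f"
| "Ck_on (Suc k) U f \<longleftrightarrow>
     f differentiable_on U \<and> (\<forall>v. Ck_on k U (\<lambda>x. frechet_derivative f (at x) v))"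

definition Cinf_on :: "'a::euclidean_space set \<Rightarrow> ('a \<Rightarrow> 'b::real_normed_vector) \<Rightarrow> bool" where
  "Cinf_on U f \<longleftrightarrow> (\<forall>k. Ck_on k U f)"

text \<open>For a (not necessarily open) subset \<open>M\<close>, smoothness means having local smooth extensions. If
  \<open>M\<close> is an embedded submanifold this is smoothness on the manifold \<open>M\<close>.\<close>

definition smooth_map_on :: "'a::euclidean_space set \<Rightarrow> ('a \<Rightarrow> 'b::real_normed_vector) \<Rightarrow> bool" where
  "smooth_map_on M f \<longleftrightarrow>
     (\<forall>p\<in>M. \<exists>U g. open U \<and> p \<in> U \<and> Cinf_on U g \<and> (\<forall>x\<in>U \<inter> M. g x = f x))"

definition tangent_space :: "'a::euclidean_space set \<Rightarrow> 'a \<Rightarrow> 'a set" where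
  "tangent_space M p =
     {v. \<exists>\<gamma> :: real \<Rightarrow> 'a. \<exists>e>0. Cinf_on {-e<..<e} \<gamma> \<and> \<gamma> ` {-e<..<e} \<subseteq> M \<and> \<gamma> 0 = p \<and>
          (\<gamma> has_vector_derivative v) (at 0)}"

text \<open>The metric on \<open>M\<close> is the restriction of the Euclidean inner product to the tangent spaces;
  for \<open>M\<close> inside the unit sphere this is the metric induced from the round sphere. A derivative of
  \<open>\<phi>\<close> within \<open>M\<close> at \<open>p\<close> need not be unique as a linear map of the ambient space, but its values on
  \<open>tangent_space M p\<close> are, and there it is the differential of \<open>\<phi> : M \<rightarrow> M\<close>.\<close>

definition riemannian_isometries :: "'a::euclidean_space set \<Rightarrow> ('a \<Rightarrow> 'a) set" where
  "riemannian_isometries M =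
     {\<phi>. bij_betw \<phi> M M \<and> smooth_map_on M \<phi> \<and> smooth_map_on M (inv_into M \<phi>) \<and>
         (\<forall>p\<in>M. \<forall>u\<in>tangent_space M p. \<forall>v\<in>tangent_space M p.
            frechet_derivative \<phi> (at p within M) u \<bullet> frechet_derivative \<phi> (at p within M) v = u \<bullet> v)}"

definition intrinsically_homogeneous :: "'a::euclidean_space set \<Rightarrow> bool" where
  "intrinsically_homogeneous M \<longleftrightarrow> (\<forall>x\<in>M. \<forall>y\<in>M. \<exists>\<phi>\<in>riemannian_isometries M. \<phi> x = y)"

end

theory Submission
  imports Defs
begin

text \<open>The Ricci curvature is preserved by isometries, and on \<open>M\<^sub>1\<close> with \<open>m = 3\<close> its largest eigenvalue is
  not constant.

  At \<open>p \<in> M\<^sub>1\<close> the vectors \<open>P\<^sub>\<alpha> p\<close> form an orthonormal basis of the normal space of \<open>M\<^sub>1\<close> in the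
  sphere, and the second fundamental form in the direction \<open>P\<^sub>\<alpha> p\<close> is \<open>- (P\<^sub>\<alpha> a) \<bullet> b\<close>. The Gauss
  equation, traced over an orthonormal basis of the tangent space, gives
  \<open>Ric(a, a) = 2 (l - m - 2) \<bar>a\<bar>\<^sup>2 + ricci_form p a\<close>, where \<open>ricci_form p a\<close> is the sum of the
  squares \<open>((P\<^sub>\<alpha> a) \<bullet> (P\<^sub>\<beta> p))\<^sup>2 = (a \<bullet> P\<^sub>\<alpha> P\<^sub>\<beta> p)\<^sup>2\<close>. For \<open>m = 3\<close> put \<open>Q = P\<^sub>0 P\<^sub>1 P\<^sub>2 P\<^sub>3\<close> and
  \<open>t = p \<bullet> Q p\<close>. The six unit vectors \<open>P\<^sub>\<alpha> P\<^sub>\<beta> p\<close> with \<open>\<alpha> < \<beta>\<close> are mutually orthogonal, except that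
  complementary pairs such as \<open>P\<^sub>0 P\<^sub>1 p\<close> and \<open>P\<^sub>2 P\<^sub>3 p\<close> have inner product \<open>\<plusminus> t\<close>. Hence the largest
  value of the form on unit vectors is \<open>2 (1 + \<bar>t\<bar>)\<close>. It is \<open>4\<close> at a unit vector with \<open>Q p = p\<close>,
  which always lies in \<open>M\<^sub>1\<close> (\<open>fixed_point_exists\<close>, \<open>ricci_form_fixed\<close>), and \<open>2\<close> at a point with
  \<open>t = 0\<close>, which exists because the dimension is large enough (\<open>null_point_exists\<close>,
  \<open>ricci_form_le\<close>). No isometry can move the first point to the second.

  The invariance (\<open>ricci_form_isometry_invariant\<close>) is Gauss's Theorema Egregium in its original
  form. A smooth retraction onto \<open>M\<^sub>1\<close>, given by an explicit formula (\<open>local_retraction\<close>), supplies a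
  smooth map \<open>X\<close> from an open set of the ambient space to \<open>M\<^sub>1\<close>. For an isometry \<open>\<phi>\<close> the maps \<open>X\<close>
  and \<open>Y = \<phi> \<circ> X\<close> have the same first fundamental form (\<open>riemannian_isometry_pullback\<close>), hence the
  same tangential parts of the second derivatives and the same expression
  \<open>X\<^sub>a\<^sub>a \<bullet> X\<^sub>b\<^sub>b - X\<^sub>a\<^sub>b \<bullet> X\<^sub>a\<^sub>b\<close> (\<open>theorema_egregium\<close>). The normal parts of the second derivatives are
  read off by differentiating the equations of \<open>M\<^sub>1\<close> twice (\<open>level_set_second_order\<close>).\<close>

section \<open>Calculus of smooth maps\<close>

text \<open>The recursion of \<open>Ck_on\<close> differentiates in a fixed direction and leaves the base point free, so the
  direction comes first.\<close>

definition dir_deriv :: "'a::euclidean_space \<Rightarrow> ('a \<Rightarrow> 'b::real_normed_vector) \<Rightarrow> 'a \<Rightarrow> 'b"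
  where "dir_deriv v f x = frechet_derivative f (at x) v"

lemma dir_deriv_eqI: "(f has_derivative f') (at x) \<Longrightarrow> dir_deriv v f x = f' v"
  unfolding dir_deriv_def by (drule frechet_derivative_at) simp

lemma has_derivative_dir_deriv:
  "f differentiable (at x) \<Longrightarrow> (f has_derivative (\<lambda>v. dir_deriv v f x)) (at x)"
  unfolding dir_deriv_def by (drule frechet_derivative_works [THEN iffD1])

lemma linear_dir_deriv: "f differentiable (at x) \<Longrightarrow> linear (\<lambda>v. dir_deriv v f x)"
  by (rule has_derivative_linear [OF has_derivative_dir_deriv])

text \<open>The Frechet derivative is a total function with arbitrary values where it does not exist. All
  identities between derivatives therefore hold on an open set only, and this lemma moves them under
  a further derivative.\<close>

lemma dir_deriv_transform:
  assumes "open U" "x \<in> U" "\<And>y. y \<in> U \<Longrightarrow> f y = g y"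
  shows "dir_deriv v f x = dir_deriv v g x"
proof -
  have "((f has_derivative D) (at x)) = ((g has_derivative D) (at x))" for D
    by (rule iffI; erule has_derivative_transform_within_open [OF _ assms(1,2)]) (simp_all add: assms(3))
  then show ?thesis
    by (simp add: dir_deriv_def frechet_derivative_def)
qed

lemma differentiable_on_open_iff:
  "open U \<Longrightarrow> f differentiable_on U \<longleftrightarrow> (\<forall>x\<in>U. f differentiable (at x))"
  by (simp add: differentiable_on_eq_differentiable_at)

lemma Ck_on_Suc_dir_deriv:
  assumes "open U"
  shows "Ck_on (Suc k) U f \<longleftrightarrow>
     (\<forall>x\<in>U. f differentiable (at x)) \<and> (\<forall>v. Ck_on k U (dir_deriv v f))"
  using assms by (simp add: differentiable_on_open_iff dir_deriv_def [abs_def])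

lemma
  assumes "open U" "Ck_on (Suc k) U f"
  shows Ck_on_Suc_differentiable: "x \<in> U \<Longrightarrow> f differentiable (at x)"
    and Ck_on_Suc_imp_dir_deriv: "Ck_on k U (dir_deriv v f)"
  using assms(2) Ck_on_Suc_dir_deriv [OF assms(1)] by blast+

lemma Ck_on_SucI:
  assumes "open U" "\<And>x. x \<in> U \<Longrightarrow> f differentiable (at x)" "\<And>v. Ck_on k U (dir_deriv v f)"
  shows "Ck_on (Suc k) U f"
  using assms Ck_on_Suc_dir_deriv [OF assms(1)] by blast

lemma Ck_on_transform:
  assumes "open U" "Ck_on k U f" "\<And>y. y \<in> U \<Longrightarrow> f y = g y"
  shows "Ck_on k U g"
  using assms(2,3)
proof (induction k arbitrary: f g)
  case 0
  then show ?case
    using continuous_on_cong [of U U f g] by simp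
next
  case (Suc k)
  show ?case
  proof (rule Ck_on_SucI [OF assms(1)])
    fix x assume "x \<in> U"
    from Ck_on_Suc_differentiable [OF assms(1) Suc.prems(1) this]
    obtain D where "(f has_derivative D) (at x)"
      by (auto simp: differentiable_def)
    then have "(g has_derivative D) (at x)"
      by (rule has_derivative_transform_within_open [OF _ assms(1) \<open>x \<in> U\<close>]) (rule Suc.prems(2))
    then show "g differentiable (at x)"
      by (auto simp: differentiable_def)
  next
    show "Ck_on k U (dir_deriv v g)" for v
      by (rule Suc.IH [OF Ck_on_Suc_imp_dir_deriv [OF assms(1) Suc.prems(1)]])
        (rule dir_deriv_transform [OF assms(1) _ Suc.prems(2)])
  qed
qed

lemma Ck_on_subset:
  assumes "open U" "open V" "V \<subseteq> U" "Ck_on k U f"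
  shows "Ck_on k V f"
  using assms(4)
  by (induction k arbitrary: f)
    (use assms continuous_on_subset in \<open>auto simp: Ck_on_Suc_dir_deriv simp del: Ck_on.simps(2)\<close>)

lemma Ck_on_Suc_imp:
  assumes "open U" "Ck_on (Suc k) U f"
  shows "Ck_on k U f"
  using assms(2)
proof (induction k arbitrary: f)
  case 0
  then show ?case
    using assms(1) by (simp add: differentiable_imp_continuous_on)
next
  case (Suc k)
  then show ?case
    using Ck_on_Suc_dir_deriv [OF assms(1)] by metis
qed

lemma Ck_on_const: "open U \<Longrightarrow> Ck_on k U (\<lambda>x. c)"
proof (induction k arbitrary: c)
  case (Suc k)
  have "dir_deriv v (\<lambda>x::'a. c) = (\<lambda>x. 0)" for v
    by (auto intro!: ext dir_deriv_eqI [where f' = "\<lambda>x. 0"] derivative_eq_intros)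
  with Suc show ?case
    by (simp add: Ck_on_Suc_dir_deriv del: Ck_on.simps(2))
qed auto

lemma Ck_on_bounded_linear:
  assumes "bounded_linear h" "open U"
  shows "Ck_on k U h"
proof (cases k)
  case 0
  then show ?thesis
    using assms by (simp add: linear_continuous_on)
next
  case (Suc j)
  have "dir_deriv v h = (\<lambda>x. h v)" for v
    by (auto intro!: ext dir_deriv_eqI bounded_linear_imp_has_derivative assms)
  moreover have "h differentiable (at x)" for x
    using assms(1) bounded_linear_imp_differentiable by blast
  ultimately show ?thesis
    using Suc assms(2) by (simp add: Ck_on_Suc_dir_deriv Ck_on_const del: Ck_on.simps(2))
qed

lemma Ck_on_add:
  assumes "open U" "Ck_on k U f" "Ck_on k U g"
  shows "Ck_on k U (\<lambda>x. f x + g x)"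
  using assms(2,3)
proof (induction k arbitrary: f g)
  case (Suc k)
  have D: "f differentiable (at x)" "g differentiable (at x)" if "x \<in> U" for x
    using Suc.prems [THEN Ck_on_Suc_differentiable [OF assms(1)]] that by blast+
  have eq: "dir_deriv v (\<lambda>x. f x + g x) x = dir_deriv v f x + dir_deriv v g x" if "x \<in> U" for v x
    by (rule dir_deriv_eqI [where f' = "\<lambda>v. dir_deriv v f x + dir_deriv v g x"])
      (intro has_derivative_add has_derivative_dir_deriv D that)
  have "Ck_on k U (\<lambda>x. dir_deriv v f x + dir_deriv v g x)" for v
    by (rule Suc.IH) (intro Suc.prems [THEN Ck_on_Suc_imp_dir_deriv [OF assms(1)]])+
  then have "Ck_on k U (dir_deriv v (\<lambda>x. f x + g x))" for v
    by (rule Ck_on_transform [OF assms(1)]) (simp add: eq)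
  with D show ?case
    by (simp add: Ck_on_Suc_dir_deriv [OF assms(1)] del: Ck_on.simps(2))
qed (auto intro: continuous_on_add)

lemma (in bounded_bilinear) Ck_on_bilinear:
  assumes "open U" "Ck_on k U f" "Ck_on k U g"
  shows "Ck_on k U (\<lambda>x. prod (f x) (g x))"
  using assms(2,3)
proof (induction k arbitrary: f g)
  case (Suc k)
  have D: "f differentiable (at x)" "g differentiable (at x)" if "x \<in> U" for x
    using Suc.prems [THEN Ck_on_Suc_differentiable [OF assms(1)]] that by blast+
  have hd: "((\<lambda>x. prod (f x) (g x)) has_derivative (\<lambda>v. prod (f x) (dir_deriv v g x) + prod (dir_deriv v f x) (g x))) (at x)"
    if "x \<in> U" for x
    by (intro FDERIV has_derivative_dir_deriv D that)
  have S: "Ck_on k U f" "Ck_on k U g"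
    using Suc.prems [THEN Ck_on_Suc_imp [OF assms(1)]] by blast+
  have "Ck_on k U (\<lambda>x. prod (f x) (dir_deriv v g x) + prod (dir_deriv v f x) (g x))" for v
    by (intro Ck_on_add assms(1) Suc.IH S)
      (intro Suc.prems [THEN Ck_on_Suc_imp_dir_deriv [OF assms(1)]])+
  then have "Ck_on k U (dir_deriv v (\<lambda>x. prod (f x) (g x)))" for v
    by (rule Ck_on_transform [OF assms(1)]) (simp add: dir_deriv_eqI [OF hd])
  then show ?case
    using hd by (auto simp: Ck_on_Suc_dir_deriv [OF assms(1)] differentiable_def simp del: Ck_on.simps(2))
qed (auto intro: continuous_on)

lemma Ck_on_sum:
  assumes "open U" "\<And>i. i \<in> I \<Longrightarrow> Ck_on k U (f i)"
  shows "Ck_on k U (\<lambda>x. \<Sum>i\<in>I. f i x)"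
  using assms(2) by (induction I rule: infinite_finite_induct) (auto intro: Ck_on_add Ck_on_const assms(1))

text \<open>The chain rule yields the derivative of \<open>g\<close> in a direction that depends on the point. Expanding that
  direction in the standard basis leaves products of one derivative of \<open>f\<close> and one of \<open>g\<close> in fixed
  directions, to which the induction applies.\<close>

lemma Ck_on_compose:
  fixes f :: "'a::euclidean_space \<Rightarrow> 'b::euclidean_space" and g :: "'b \<Rightarrow> 'c::real_normed_vector"
  assumes "open U" "open V" "f ` U \<subseteq> V" "Ck_on k U f" "Ck_on k V g"
  shows "Ck_on k U (\<lambda>x. g (f x))"
  using assms(4,5)
proof (induction k arbitrary: g)
  case 0
  then show ?case
    using assms(3) continuous_on_compose2 by auto
next
  case (Suc k)
  have Df: "f differentiable (at x)" if "x \<in> U" for x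
    using Ck_on_Suc_differentiable [OF assms(1) Suc.prems(1)] that by blast
  have Dg: "g differentiable (at (f x))" if "x \<in> U" for x
    using Ck_on_Suc_differentiable [OF assms(2) Suc.prems(2)] that assms(3) by blast
  have hd: "((\<lambda>x. g (f x)) has_derivative (\<lambda>v. dir_deriv (dir_deriv v f x) g (f x))) (at x)"
    if "x \<in> U" for x
    using diff_chain_at [OF has_derivative_dir_deriv [OF Df] has_derivative_dir_deriv [OF Dg]] that
    by (simp add: o_def)
  have expand: "dir_deriv (dir_deriv v f x) g (f x) =
      (\<Sum>b\<in>Basis. (dir_deriv v f x \<bullet> b) *\<^sub>R dir_deriv b g (f x))" if "x \<in> U" for v x
  proof -
    interpret L: linear "\<lambda>v. dir_deriv v g (f x)"
      by (rule linear_dir_deriv [OF Dg [OF that]])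
    have "dir_deriv (\<Sum>b\<in>Basis. (dir_deriv v f x \<bullet> b) *\<^sub>R b) g (f x) =
      (\<Sum>b\<in>Basis. (dir_deriv v f x \<bullet> b) *\<^sub>R dir_deriv b g (f x))"
      by (simp only: L.sum L.scaleR)
    then show ?thesis
      by (simp only: euclidean_representation)
  qed
  have C: "Ck_on k U f"
    using Ck_on_Suc_imp [OF assms(1) Suc.prems(1)] .
  have "Ck_on k U (\<lambda>x. \<Sum>b\<in>Basis. (dir_deriv v f x \<bullet> b) *\<^sub>R dir_deriv b g (f x))" for v
  proof (intro Ck_on_sum assms(1) bounded_bilinear.Ck_on_bilinear [OF bounded_bilinear_scaleR]
      bounded_bilinear.Ck_on_bilinear [OF bounded_bilinear_inner] Ck_on_const)
    show "Ck_on k U (dir_deriv v f)"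
      using Ck_on_Suc_imp_dir_deriv [OF assms(1) Suc.prems(1)] .
    show "Ck_on k U (\<lambda>x. dir_deriv b g (f x))" for b
      by (rule Suc.IH [OF C Ck_on_Suc_imp_dir_deriv [OF assms(2) Suc.prems(2)]])
  qed
  then have "Ck_on k U (dir_deriv v (\<lambda>x. g (f x)))" for v
    by (rule Ck_on_transform [OF assms(1)]) (simp add: dir_deriv_eqI [OF hd] expand)
  then show ?case
    using hd by (auto simp: Ck_on_Suc_dir_deriv [OF assms(1)] differentiable_def simp del: Ck_on.simps(2))
qed

text \<open>The constant \<open>c\<close> makes the family closed under differentiation. The exponents \<open>-1\<close> and \<open>\<plusminus> 1/2\<close> give
  reciprocals and square roots.\<close>

lemma Ck_on_powr: "Ck_on k {0<..} (\<lambda>x::real. c * x powr a)"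
proof (induction k arbitrary: a c)
  case 0
  then show ?case
    by (auto intro!: continuous_intros)
next
  case (Suc k)
  have hd: "((\<lambda>x::real. c * x powr a) has_derivative (\<lambda>v. (v * c * a) * x powr (a - 1))) (at x)"
    if "x > 0" for x
  proof -
    have "((\<lambda>x::real. c * x powr a) has_real_derivative c * (a * x powr (a - 1))) (at x)"
      using that by (intro DERIV_cmult has_real_derivative_powr)
    then show ?thesis
      by (auto simp: has_field_derivative_def mult_ac elim!: has_derivative_eq_rhs)
  qed
  have "Ck_on k {0<..} (dir_deriv v (\<lambda>x::real. c * x powr a))" for v
    by (rule Ck_on_transform [OF _ Suc.IH [of "v * c * a" "a - 1"]]) (auto simp: dir_deriv_eqI [OF hd])
  then show ?case
    using hd by (auto simp: Ck_on_Suc_dir_deriv differentiable_def simp del: Ck_on.simps(2))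
qed

lemma Cinf_on_differentiable: "open U \<Longrightarrow> Cinf_on U f \<Longrightarrow> x \<in> U \<Longrightarrow> f differentiable (at x)"
  by (metis Cinf_on_def Ck_on_Suc_dir_deriv)

lemma Cinf_on_dir_deriv: "open U \<Longrightarrow> Cinf_on U f \<Longrightarrow> Cinf_on U (dir_deriv v f)"
  by (metis Cinf_on_def Ck_on_Suc_dir_deriv)

lemma Cinf_on_continuous: "Cinf_on U f \<Longrightarrow> continuous_on U f"
  by (metis Cinf_on_def Ck_on.simps(1))

lemma Cinf_on_subset: "open U \<Longrightarrow> open V \<Longrightarrow> V \<subseteq> U \<Longrightarrow> Cinf_on U f \<Longrightarrow> Cinf_on V f"
  by (metis Cinf_on_def Ck_on_subset)

lemma Cinf_on_const: "open U \<Longrightarrow> Cinf_on U (\<lambda>x. c)"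
  by (simp add: Cinf_on_def Ck_on_const)

lemma Cinf_on_bounded_linear: "bounded_linear h \<Longrightarrow> open U \<Longrightarrow> Cinf_on U h"
  by (simp add: Cinf_on_def Ck_on_bounded_linear)

lemma Cinf_on_add: "open U \<Longrightarrow> Cinf_on U f \<Longrightarrow> Cinf_on U g \<Longrightarrow> Cinf_on U (\<lambda>x. f x + g x)"
  by (simp add: Cinf_on_def Ck_on_add)

lemma Cinf_on_sum:
  "open U \<Longrightarrow> (\<And>i. i \<in> I \<Longrightarrow> Cinf_on U (f i)) \<Longrightarrow> Cinf_on U (\<lambda>x. \<Sum>i\<in>I. f i x)"
  by (simp add: Cinf_on_def Ck_on_sum)

lemma (in bounded_bilinear) Cinf_on_bilinear:
  "open U \<Longrightarrow> Cinf_on U f \<Longrightarrow> Cinf_on U g \<Longrightarrow> Cinf_on U (\<lambda>x. prod (f x) (g x))"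
  by (simp add: Cinf_on_def Ck_on_bilinear)

lemmas Cinf_on_scaleR = bounded_bilinear.Cinf_on_bilinear [OF bounded_bilinear_scaleR]
  and Cinf_on_inner = bounded_bilinear.Cinf_on_bilinear [OF bounded_bilinear_inner]
  and Cinf_on_mult = bounded_bilinear.Cinf_on_bilinear [OF bounded_bilinear_mult]

lemma Cinf_on_compose:
  fixes f :: "'a::euclidean_space \<Rightarrow> 'b::euclidean_space" and g :: "'b \<Rightarrow> 'c::real_normed_vector"
  shows "open U \<Longrightarrow> open V \<Longrightarrow> f ` U \<subseteq> V \<Longrightarrow> Cinf_on U f \<Longrightarrow> Cinf_on V g \<Longrightarrow> Cinf_on U (\<lambda>x. g (f x))"
  unfolding Cinf_on_def using Ck_on_compose by metis

lemma Cinf_on_powr: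
  fixes f :: "'a::euclidean_space \<Rightarrow> real"
  assumes "open U" "Cinf_on U f" "\<And>x. x \<in> U \<Longrightarrow> f x > 0"
  shows "Cinf_on U (\<lambda>x. f x powr a)"
  using Cinf_on_compose [OF assms(1) open_greaterThan _ assms(2), of 0 "\<lambda>x. x powr a"] Ck_on_powr [of _ 1 a]
    assms(3) by (auto simp: Cinf_on_def)

text \<open>Two applications of the mean value theorem. The left side is symmetric in the two directions, so
  letting \<open>t\<close> tend to zero shows that continuous second derivatives commute.\<close>

lemma mixed_difference_mvt:
  fixes f :: "'a::euclidean_space \<Rightarrow> real"
  assumes "open U" "Cinf_on U f" "t > 0"
    and U: "\<And>s r. 0 \<le> s \<Longrightarrow> s \<le> t \<Longrightarrow> 0 \<le> r \<Longrightarrow> r \<le> t \<Longrightarrow> x + s *\<^sub>R a + r *\<^sub>R b \<in> U"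
  obtains s r where "0 < s" "s < t" "0 < r" "r < t"
    "f (x + t *\<^sub>R a + t *\<^sub>R b) - f (x + t *\<^sub>R a) - f (x + t *\<^sub>R b) + f x
       = t * t * dir_deriv b (dir_deriv a f) (x + s *\<^sub>R a + r *\<^sub>R b)"
proof -
  have D: "((\<lambda>s. g (c + s *\<^sub>R d)) has_real_derivative dir_deriv d g (c + s *\<^sub>R d)) (at s)"
    if "Cinf_on U g" "c + s *\<^sub>R d \<in> U" for g :: "'a \<Rightarrow> real" and c d s
  proof -
    have "((\<lambda>s. c + s *\<^sub>R d) has_derivative (\<lambda>h. h *\<^sub>R d)) (at s)"
      by (auto intro!: derivative_eq_intros)
    from diff_chain_at [OF this has_derivative_dir_deriv [OF Cinf_on_differentiable [OF assms(1) that]]]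
    have "((\<lambda>s. g (c + s *\<^sub>R d)) has_derivative (\<lambda>h. dir_deriv (h *\<^sub>R d) g (c + s *\<^sub>R d))) (at s)"
      by (simp add: o_def)
    then show ?thesis
      by (simp add: has_field_derivative_def linear_cmul
          [OF linear_dir_deriv [OF Cinf_on_differentiable [OF assms(1) that]]] mult_commute_abs)
  qed
  let ?\<phi> = "\<lambda>s. f ((x + t *\<^sub>R b) + s *\<^sub>R a) - f (x + s *\<^sub>R a)"
  have "\<exists>s>0. s < t \<and> ?\<phi> t - ?\<phi> 0 = (t - 0) * (dir_deriv a f ((x + t *\<^sub>R b) + s *\<^sub>R a) - dir_deriv a f (x + s *\<^sub>R a))"
  proof (rule MVT2 [OF assms(3)])
    show "(?\<phi> has_real_derivative
        dir_deriv a f ((x + t *\<^sub>R b) + s *\<^sub>R a) - dir_deriv a f (x + s *\<^sub>R a)) (at s)"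
      if "0 \<le> s" "s \<le> t" for s
      using U [of s t] U [of s 0] that assms(3)
      by (intro DERIV_diff D assms(2)) (auto simp: add_ac)
  qed
  then obtain s where s: "0 < s" "s < t"
    and 1: "?\<phi> t - ?\<phi> 0 = t * (dir_deriv a f ((x + t *\<^sub>R b) + s *\<^sub>R a) - dir_deriv a f (x + s *\<^sub>R a))"
    by auto
  let ?\<psi> = "\<lambda>r. dir_deriv a f ((x + s *\<^sub>R a) + r *\<^sub>R b)"
  have "\<exists>r>0. r < t \<and> ?\<psi> t - ?\<psi> 0 = (t - 0) * dir_deriv b (dir_deriv a f) ((x + s *\<^sub>R a) + r *\<^sub>R b)"
    by (rule MVT2 [OF assms(3)])
      (use U [of s] s in \<open>auto intro!: D Cinf_on_dir_deriv assms(1,2)\<close>)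
  then obtain r where r: "0 < r" "r < t"
    and 2: "?\<psi> t - ?\<psi> 0 = t * dir_deriv b (dir_deriv a f) ((x + s *\<^sub>R a) + r *\<^sub>R b)"
    by auto
  show thesis
  proof (rule that [OF s r])
    have e: "x + t *\<^sub>R b + s *\<^sub>R a = x + s *\<^sub>R a + t *\<^sub>R b" "x + t *\<^sub>R b + t *\<^sub>R a = x + t *\<^sub>R a + t *\<^sub>R b"
      by simp_all
    show "f (x + t *\<^sub>R a + t *\<^sub>R b) - f (x + t *\<^sub>R a) - f (x + t *\<^sub>R b) + f x
       = t * t * dir_deriv b (dir_deriv a f) (x + s *\<^sub>R a + r *\<^sub>R b)"
      using 1 2 by (simp add: e)
  qed
qed

lemma dir_deriv_commute_real:
  fixes f :: "'a::euclidean_space \<Rightarrow> real"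
  assumes "open U" "Cinf_on U f" "x \<in> U"
  shows "dir_deriv a (dir_deriv b f) x = dir_deriv b (dir_deriv a f) x"
proof (rule ccontr)
  let ?A = "dir_deriv b (dir_deriv a f)" and ?B = "dir_deriv a (dir_deriv b f)"
  assume "?B x \<noteq> ?A x"
  define e where "e = dist (?A x) (?B x) / 2"
  have "e > 0"
    using \<open>?B x \<noteq> ?A x\<close> by (simp add: e_def)
  have cont: "isCont ?A x" "isCont ?B x"
    using assms Cinf_on_continuous Cinf_on_dir_deriv continuous_on_eq_continuous_at by metis+
  obtain d1 where d1: "d1 > 0" "\<And>y. dist y x < d1 \<Longrightarrow> dist (?A y) (?A x) < e"
    using cont(1) \<open>e > 0\<close> by (metis continuous_at_eps_delta)
  obtain d2 where d2: "d2 > 0" "\<And>y. dist y x < d2 \<Longrightarrow> dist (?B y) (?B x) < e"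
    using cont(2) \<open>e > 0\<close> by (metis continuous_at_eps_delta)
  obtain d3 where d3: "d3 > 0" "\<And>y. dist y x < d3 \<Longrightarrow> y \<in> U"
    using assms(1,3) by (metis open_dist)
  define d where "d = Min {d1, d2, d3}"
  have d: "d > 0" "d \<le> d1" "d \<le> d2" "d \<le> d3"
    using d1 d2 d3 by (auto simp: d_def)
  define t where "t = d / (2 * (norm a + norm b + 1))"
  have pos: "norm a + norm b + 1 > 0"
    by (simp add: add_nonneg_pos)
  then have "t > 0"
    using d by (simp add: t_def)
  have small: "dist (x + s *\<^sub>R a + r *\<^sub>R b) x < d" if "0 \<le> s" "s \<le> t" "0 \<le> r" "r \<le> t" for s r
  proof -
    have "dist (x + s *\<^sub>R a + r *\<^sub>R b) x = norm (s *\<^sub>R a + r *\<^sub>R b)"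
      by (simp add: dist_norm)
    also have "\<dots> \<le> s * norm a + r * norm b"
      using that norm_triangle_ineq [of "s *\<^sub>R a" "r *\<^sub>R b"] by simp
    also have "\<dots> \<le> t * norm a + t * norm b"
      using that by (intro add_mono mult_right_mono) auto
    also have "\<dots> < 2 * (t * (norm a + norm b + 1))"
      using \<open>t > 0\<close> pos by (simp add: algebra_simps add_nonneg_pos add_pos_nonneg)
    also have "\<dots> = d"
      using pos unfolding t_def by (simp add: field_simps)
    finally show ?thesis .
  qed
  have small': "dist (x + s *\<^sub>R b + r *\<^sub>R a) x < d" if "0 \<le> s" "s \<le> t" "0 \<le> r" "r \<le> t" for s r
    using small [of r s] that by (simp add: algebra_simps)
  obtain s r where sr: "0 < s" "s < t" "0 < r" "r < t"
    "f (x + t *\<^sub>R a + t *\<^sub>R b) - f (x + t *\<^sub>R a) - f (x + t *\<^sub>R b) + f x = t * t * ?A (x + s *\<^sub>R a + r *\<^sub>R b)"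
    by (rule mixed_difference_mvt [OF assms(1,2) \<open>t > 0\<close>, of x a b]) (use small d d3 in fastforce)+
  obtain s' r' where sr': "0 < s'" "s' < t" "0 < r'" "r' < t"
    "f (x + t *\<^sub>R b + t *\<^sub>R a) - f (x + t *\<^sub>R b) - f (x + t *\<^sub>R a) + f x = t * t * ?B (x + s' *\<^sub>R b + r' *\<^sub>R a)"
    by (rule mixed_difference_mvt [OF assms(1,2) \<open>t > 0\<close>, of x b a]) (use small' d d3 in fastforce)+
  have e: "x + t *\<^sub>R b + t *\<^sub>R a = x + t *\<^sub>R a + t *\<^sub>R b"
    by simp
  have "t * t * ?A (x + s *\<^sub>R a + r *\<^sub>R b) = t * t * ?B (x + s' *\<^sub>R b + r' *\<^sub>R a)"
    using sr(5) sr'(5) unfolding e by linarith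
  then have "?A (x + s *\<^sub>R a + r *\<^sub>R b) = ?B (x + s' *\<^sub>R b + r' *\<^sub>R a)"
    using \<open>t > 0\<close> by simp
  moreover have "dist (?A (x + s *\<^sub>R a + r *\<^sub>R b)) (?A x) < e"
    by (rule d1(2)) (use small [of s r] sr d in linarith)
  moreover have "dist (?B (x + s' *\<^sub>R b + r' *\<^sub>R a)) (?B x) < e"
    by (rule d2(2)) (use small' [of s' r'] sr' d in linarith)
  ultimately show False
    using dist_triangle_half_r [of "?A (x + s *\<^sub>R a + r *\<^sub>R b)" "?A x" "2 * e" "?B x"]
    by (simp add: e_def)
qed

lemma dir_deriv_inner:
  fixes f g :: "'a::euclidean_space \<Rightarrow> 'b::real_inner"
  assumes "f differentiable (at x)" "g differentiable (at x)"
  shows "dir_deriv v (\<lambda>x. f x \<bullet> g x) x = f x \<bullet> dir_deriv v g x + dir_deriv v f x \<bullet> g x"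
  by (rule dir_deriv_eqI [OF has_derivative_inner [OF assms [THEN has_derivative_dir_deriv]]])

text \<open>Pairing with a fixed vector reduces the claim to real-valued maps.\<close>

lemma dir_deriv_commute:
  fixes f :: "'a::euclidean_space \<Rightarrow> 'b::euclidean_space"
  assumes "open U" "Cinf_on U f" "x \<in> U"
  shows "dir_deriv a (dir_deriv b f) x = dir_deriv b (dir_deriv a f) x"
proof (rule euclidean_eqI)
  fix w :: 'b
  have C: "Cinf_on U (\<lambda>y. f y \<bullet> w)"
    by (intro Cinf_on_inner assms Cinf_on_const)
  have 1: "dir_deriv a (\<lambda>y. g y \<bullet> w) y = dir_deriv a g y \<bullet> w" if "y \<in> U" "Cinf_on U g" for g y a
    using dir_deriv_inner [of g y "\<lambda>_. w" a] Cinf_on_differentiable [OF assms(1) that(2,1)]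
    by (simp add: dir_deriv_eqI [OF has_derivative_const])
  have 2: "dir_deriv a (dir_deriv b (\<lambda>y. f y \<bullet> w)) x = dir_deriv a (dir_deriv b f) x \<bullet> w" for a b
  proof -
    have "dir_deriv a (dir_deriv b (\<lambda>y. f y \<bullet> w)) x = dir_deriv a (\<lambda>y. dir_deriv b f y \<bullet> w) x"
      by (rule dir_deriv_transform [OF assms(1,3)]) (simp add: 1 assms)
    then show ?thesis
      by (simp add: 1 assms Cinf_on_dir_deriv)
  qed
  show "dir_deriv a (dir_deriv b f) x \<bullet> w = dir_deriv b (dir_deriv a f) x \<bullet> w"
    using dir_deriv_commute_real [OF assms(1) C assms(3), of a b] by (simp add: 2)
qed


section \<open>The Gauss equation\<close>

lemma dir_deriv_inner_Cinf:
  fixes f g :: "'a::euclidean_space \<Rightarrow> 'b::real_inner"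
  assumes "open U" "Cinf_on U f" "Cinf_on U g" "x \<in> U"
  shows "dir_deriv v (\<lambda>x. f x \<bullet> g x) x = dir_deriv v f x \<bullet> g x + f x \<bullet> dir_deriv v g x"
  using dir_deriv_inner [OF Cinf_on_differentiable [OF assms(1,2,4)] Cinf_on_differentiable [OF assms(1,3,4)]]
  by (simp add: add.commute)

text \<open>The Koszul formula: the symmetry of second derivatives allows three derivatives of the metric
  coefficients to be combined so that only one inner product survives.\<close>

lemma second_derivative_inner_first:
  fixes X :: "'a::euclidean_space \<Rightarrow> 'b::euclidean_space"
  assumes "open U" "Cinf_on U X" "x \<in> U"
  shows "2 * (dir_deriv a (dir_deriv b X) x \<bullet> dir_deriv c X x) =
      dir_deriv a (\<lambda>x. dir_deriv b X x \<bullet> dir_deriv c X x) x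
    + dir_deriv b (\<lambda>x. dir_deriv a X x \<bullet> dir_deriv c X x) x
    - dir_deriv c (\<lambda>x. dir_deriv a X x \<bullet> dir_deriv b X x) x"
  using dir_deriv_commute [OF assms, of b a] dir_deriv_commute [OF assms, of c a]
    dir_deriv_commute [OF assms, of c b]
  by (simp add: dir_deriv_inner_Cinf [OF assms(1) _ _ assms(3)] Cinf_on_dir_deriv assms inner_commute)

lemma third_derivative_commute:
  fixes X :: "'a::euclidean_space \<Rightarrow> 'b::euclidean_space"
  assumes "open U" "Cinf_on U X" "x \<in> U"
  shows "dir_deriv b (dir_deriv a (dir_deriv a X)) x = dir_deriv a (dir_deriv a (dir_deriv b X)) x"
proof -
  have "dir_deriv b (dir_deriv a (dir_deriv a X)) x = dir_deriv a (dir_deriv b (dir_deriv a X)) x"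
    by (rule dir_deriv_commute [OF assms(1) Cinf_on_dir_deriv [OF assms(1,2)] assms(3)])
  also have "\<dots> = dir_deriv a (dir_deriv a (dir_deriv b X)) x"
    by (rule dir_deriv_transform [OF assms(1,3)], rule dir_deriv_commute [OF assms(1,2)])
  finally show ?thesis .
qed

text \<open>Both derivatives on the right produce a term with a third derivative of \<open>X\<close>, and the two terms cancel
  by \<open>third_derivative_commute\<close>.\<close>

lemma gauss_expression:
  fixes X :: "'a::euclidean_space \<Rightarrow> 'b::euclidean_space"
  assumes "open U" "Cinf_on U X" "x \<in> U"
  shows "dir_deriv a (dir_deriv a X) x \<bullet> dir_deriv b (dir_deriv b X) x
        - dir_deriv a (dir_deriv b X) x \<bullet> dir_deriv a (dir_deriv b X) x
      = dir_deriv b (\<lambda>x. dir_deriv a (dir_deriv a X) x \<bullet> dir_deriv b X x) x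
        - dir_deriv a (\<lambda>x. dir_deriv a (dir_deriv b X) x \<bullet> dir_deriv b X x) x"
  using third_derivative_commute [OF assms, of b a]
  by (simp add: dir_deriv_inner_Cinf [OF assms(1) _ _ assms(3)] Cinf_on_dir_deriv assms)

text \<open>By the Koszul formula the inner products of second with first derivatives are determined by the
  metric at every point of \<open>U\<close>. They can thus be differentiated again, and \<open>gauss_expression\<close> is a
  difference of two such derivatives.\<close>

proposition
  fixes X :: "'a::euclidean_space \<Rightarrow> 'b::euclidean_space" and Y :: "'a \<Rightarrow> 'c::euclidean_space"
  assumes "open U" "Cinf_on U X" "Cinf_on U Y"
    and metric: "\<And>x a b. x \<in> U \<Longrightarrow> dir_deriv a X x \<bullet> dir_deriv b X x = dir_deriv a Y x \<bullet> dir_deriv b Y x"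
    and "x \<in> U"
  shows isometric_second_inner_first:
      "dir_deriv a (dir_deriv b X) x \<bullet> dir_deriv c X x = dir_deriv a (dir_deriv b Y) x \<bullet> dir_deriv c Y x"
      (is ?first)
    and theorema_egregium:
      "dir_deriv a (dir_deriv a X) x \<bullet> dir_deriv b (dir_deriv b X) x
        - dir_deriv a (dir_deriv b X) x \<bullet> dir_deriv a (dir_deriv b X) x
      = dir_deriv a (dir_deriv a Y) x \<bullet> dir_deriv b (dir_deriv b Y) x
        - dir_deriv a (dir_deriv b Y) x \<bullet> dir_deriv a (dir_deriv b Y) x"
      (is ?second)
proof -
  have D: "dir_deriv d (\<lambda>x. dir_deriv a X x \<bullet> dir_deriv b X x) y
      = dir_deriv d (\<lambda>x. dir_deriv a Y x \<bullet> dir_deriv b Y x) y" if "y \<in> U" for a b d y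
    by (rule dir_deriv_transform [OF assms(1) that metric])
  have first: "dir_deriv a (dir_deriv b X) y \<bullet> dir_deriv c X y
      = dir_deriv a (dir_deriv b Y) y \<bullet> dir_deriv c Y y" if "y \<in> U" for a b c y
    using second_derivative_inner_first [OF assms(1,2) that, of a b c]
      second_derivative_inner_first [OF assms(1,3) that, of a b c] D [OF that] by simp
  show ?first
    by (rule first [OF assms(5)])
  have "dir_deriv d (\<lambda>x. dir_deriv a (dir_deriv b X) x \<bullet> dir_deriv c X x) x
      = dir_deriv d (\<lambda>x. dir_deriv a (dir_deriv b Y) x \<bullet> dir_deriv c Y x) x" for a b c d
    by (rule dir_deriv_transform [OF assms(1,5) first])
  then show ?second
    by (simp add: gauss_expression [OF assms(1,2,5)] gauss_expression [OF assms(1,3,5)])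
qed

text \<open>The first and second derivatives of \<open>A (Y x) \<bullet> Y x\<close> vanish. For \<open>Y\<close> with values in a level set of
  the quadratic form of \<open>A\<close> this determines the component of the second derivative along the normal
  vector \<open>A (Y x)\<close>.\<close>

lemma
  fixes Y :: "'a::euclidean_space \<Rightarrow> 'b::euclidean_space"
  assumes "open U" "Cinf_on U Y" and A: "bounded_linear A" "\<And>u v. A u \<bullet> v = u \<bullet> A v"
    and const: "\<And>x. x \<in> U \<Longrightarrow> A (Y x) \<bullet> Y x = c" and "x \<in> U"
  shows level_set_first_order: "dir_deriv a Y x \<bullet> A (Y x) = 0"
    and level_set_second_order:
      "dir_deriv a (dir_deriv b Y) x \<bullet> A (Y x) = - (A (dir_deriv a Y x) \<bullet> dir_deriv b Y x)"
proof -
  have DA: "dir_deriv a (\<lambda>x. A (Y x)) y = A (dir_deriv a Y y)" if "y \<in> U" for a y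
    by (rule dir_deriv_eqI, rule bounded_linear.has_derivative [OF A(1)], rule has_derivative_dir_deriv)
      (rule Cinf_on_differentiable [OF assms(1,2) that])
  have CA: "Cinf_on U (\<lambda>x. A (Y x))"
    using Cinf_on_compose [OF assms(1) open_UNIV _ assms(2) Cinf_on_bounded_linear [OF A(1)]] by simp
  have zero: "dir_deriv a (\<lambda>x. k) y = 0" for a y and k :: real
    by (rule dir_deriv_eqI [where f' = "\<lambda>_. 0"]) simp
  have one: "dir_deriv a Y y \<bullet> A (Y y) = 0" if "y \<in> U" for a y
  proof -
    have "dir_deriv a (\<lambda>x. A (Y x) \<bullet> Y x) y = dir_deriv a (\<lambda>x. c) y"
      by (rule dir_deriv_transform [OF assms(1) that const])
    then have "A (dir_deriv a Y y) \<bullet> Y y + A (Y y) \<bullet> dir_deriv a Y y = 0"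
      using that by (simp add: dir_deriv_inner_Cinf [OF assms(1) CA assms(2)] DA zero)
    then show ?thesis
      using A(2) [of "dir_deriv a Y y" "Y y"] by (simp add: inner_commute)
  qed
  show "dir_deriv a Y x \<bullet> A (Y x) = 0"
    by (rule one [OF assms(6)])
  have "dir_deriv a (\<lambda>x. dir_deriv b Y x \<bullet> A (Y x)) x = dir_deriv a (\<lambda>x. 0) x"
    by (rule dir_deriv_transform [OF assms(1,6) one])
  then show "dir_deriv a (dir_deriv b Y) x \<bullet> A (Y x) = - (A (dir_deriv a Y x) \<bullet> dir_deriv b Y x)"
    using assms(6) dir_deriv_inner_Cinf [OF assms(1) Cinf_on_dir_deriv [OF assms(1,2)] CA, of x a b]
    by (simp add: DA zero inner_commute)
qed

section \<open>Smooth local parametrisations and Riemannian isometries\<close>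

text \<open>The curve that represents the tangent vector is the image under \<open>X\<close> of a straight line through \<open>x\<close>.\<close>

lemma dir_deriv_mem_tangent_space:
  fixes X :: "'a::euclidean_space \<Rightarrow> 'b::euclidean_space"
  assumes "open U" "Cinf_on U X" "X ` U \<subseteq> M" "x \<in> U"
  obtains e where "e > 0" "\<And>s. s \<in> {-e<..<e} \<Longrightarrow> x + s *\<^sub>R a \<in> U"
    "((\<lambda>s. X (x + s *\<^sub>R a)) has_vector_derivative dir_deriv a X x) (at 0)"
    "dir_deriv a X x \<in> tangent_space M (X x)"
proof -
  let ?c = "\<lambda>s::real. x + s *\<^sub>R a"
  have "open (?c -` U)"
    by (intro continuous_open_vimage assms(1) continuous_intros)
  moreover have "0 \<in> ?c -` U"
    using assms(4) by simp
  ultimately obtain e where e: "e > 0" "ball 0 e \<subseteq> ?c -` U"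
    by (meson open_contains_ball)
  then have in_U: "?c s \<in> U" if "s \<in> {-e<..<e}" for s
    using that subsetD [OF e(2), of s] by (auto simp: dist_real_def)
  have "(?c has_derivative (\<lambda>h. h *\<^sub>R a)) (at 0)"
    by (auto intro!: derivative_eq_intros)
  moreover have "(X has_derivative (\<lambda>v. dir_deriv v X x)) (at (?c 0))"
    using has_derivative_dir_deriv [OF Cinf_on_differentiable [OF assms(1,2,4)]] by simp
  ultimately have "((\<lambda>s. X (?c s)) has_derivative (\<lambda>h. dir_deriv (h *\<^sub>R a) X x)) (at 0)"
    using diff_chain_at [of ?c "\<lambda>h. h *\<^sub>R a" 0 X] by (simp add: o_def)
  then have D: "((\<lambda>s. X (?c s)) has_vector_derivative dir_deriv a X x) (at 0)"
    by (simp add: has_vector_derivative_def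
        linear_cmul [OF linear_dir_deriv [OF Cinf_on_differentiable [OF assms(1,2,4)]]])
  have "Cinf_on {-e<..<e} ?c"
    by (intro Cinf_on_add Cinf_on_const Cinf_on_bounded_linear bounded_linear_scaleR_left) auto
  then have "Cinf_on {-e<..<e} (\<lambda>s. X (?c s))"
    by (rule Cinf_on_compose [OF _ assms(1) _ _ assms(2), rotated 2]) (use in_U in auto)
  then have "dir_deriv a X x \<in> tangent_space M (X x)"
    unfolding tangent_space_def using e(1) D in_U assms(3)
    by (intro CollectI exI [of _ "\<lambda>s. X (?c s)"] exI [of _ e]) auto
  with e(1) in_U D show thesis
    using that by blast
qed

lemma smooth_map_on_differentiable:
  assumes "smooth_map_on M \<phi>" "p \<in> M"
  shows "\<phi> differentiable (at p within M)"
proof -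
  obtain U g where g: "open U" "p \<in> U" "Cinf_on U g" "\<And>x. x \<in> U \<inter> M \<Longrightarrow> g x = \<phi> x"
    using assms unfolding smooth_map_on_def by metis
  have "(g has_derivative (\<lambda>v. dir_deriv v g p)) (at p within M)"
    using has_derivative_dir_deriv [OF Cinf_on_differentiable [OF g(1,3,2)]]
    by (rule has_derivative_at_withinI)
  then have "(\<phi> has_derivative (\<lambda>v. dir_deriv v g p)) (at p within M)"
    by (rule has_derivative_transform_eventually)
      (use g assms(2) in \<open>auto simp: eventually_at_topological\<close>)
  then show ?thesis
    by (auto simp: differentiable_def)
qed

text \<open>Differentiating \<open>\<phi> (X (x + s a)) = Y (x + s a)\<close> at \<open>s = 0\<close> shows that the differential of \<open>\<phi>\<close> sends
  \<open>dir_deriv a X x\<close> to \<open>dir_deriv a Y x\<close>. The chain rule is applied within the image of the curve,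
  since \<open>\<phi>\<close> is differentiable only relative to \<open>M\<close>.\<close>

lemma riemannian_isometry_pullback:
  fixes X :: "'a::euclidean_space \<Rightarrow> 'b::euclidean_space"
  assumes "\<phi> \<in> riemannian_isometries M"
    and "open U" "Cinf_on U X" "X ` U \<subseteq> M" "Cinf_on U Y" "\<And>x. x \<in> U \<Longrightarrow> Y x = \<phi> (X x)" "x \<in> U"
  shows "dir_deriv a X x \<bullet> dir_deriv b X x = dir_deriv a Y x \<bullet> dir_deriv b Y x"
proof -
  have X: "X x \<in> M"
    using assms by auto
  let ?D = "frechet_derivative \<phi> (at (X x) within M)"
  have "\<phi> differentiable (at (X x) within M)"
    using assms(1) X by (simp add: riemannian_isometries_def smooth_map_on_differentiable)
  then have D: "(\<phi> has_derivative ?D) (at (X x) within M)"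
    by (rule frechet_derivative_works [THEN iffD1])
  have push: "?D (dir_deriv a X x) = dir_deriv a Y x" and tan: "dir_deriv a X x \<in> tangent_space M (X x)"
    for a
  proof -
    obtain e where e: "e > 0" "\<And>s. s \<in> {-e<..<e} \<Longrightarrow> x + s *\<^sub>R a \<in> U"
      and DX: "((\<lambda>s. X (x + s *\<^sub>R a)) has_vector_derivative dir_deriv a X x) (at 0)"
      and tan: "dir_deriv a X x \<in> tangent_space M (X x)"
      using dir_deriv_mem_tangent_space [OF assms(2,3,4,7)] by metis
    show "dir_deriv a X x \<in> tangent_space M (X x)"
      by (rule tan)
    have DY: "((\<lambda>s. Y (x + s *\<^sub>R a)) has_vector_derivative dir_deriv a Y x) (at 0)"
      using dir_deriv_mem_tangent_space [OF assms(2,5) subset_UNIV assms(7)] by metis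
    have "((\<lambda>s. \<phi> (X (x + s *\<^sub>R a))) has_derivative (\<lambda>h. ?D (h *\<^sub>R dir_deriv a X x))) (at 0 within {-e<..<e})"
    proof (rule has_derivative_in_compose [where f = "\<lambda>s. X (x + s *\<^sub>R a)" and g = \<phi> and g' = ?D
          and f' = "\<lambda>h. h *\<^sub>R dir_deriv a X x"])
      show "((\<lambda>s. X (x + s *\<^sub>R a)) has_derivative (\<lambda>h. h *\<^sub>R dir_deriv a X x)) (at 0 within {-e<..<e})"
        using DX by (simp add: has_vector_derivative_def has_derivative_at_withinI)
      show "(\<phi> has_derivative ?D) (at (X (x + 0 *\<^sub>R a)) within (\<lambda>s. X (x + s *\<^sub>R a)) ` {-e<..<e})"
        by (rule has_derivative_subset [where s = M]) (use e assms(4) D in auto)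
    qed
    then have "((\<lambda>s. \<phi> (X (x + s *\<^sub>R a))) has_vector_derivative ?D (dir_deriv a X x)) (at 0)"
      using e(1) linear_cmul [OF has_derivative_linear [OF D]]
      by (simp add: has_vector_derivative_def at_within_open [where S = "{-e<..<e}"])
    then have "((\<lambda>s. Y (x + s *\<^sub>R a)) has_vector_derivative ?D (dir_deriv a X x)) (at 0)"
      by (rule has_vector_derivative_transform_within_open [where S = "{-e<..<e}"])
        (use e assms(6) in auto)
    then show "?D (dir_deriv a X x) = dir_deriv a Y x"
      using DY vector_derivative_unique_at by blast
  qed
  have "?D (dir_deriv a X x) \<bullet> ?D (dir_deriv b X x) = dir_deriv a X x \<bullet> dir_deriv b X x"
    using assms(1) X tan by (simp add: riemannian_isometries_def)
  then show ?thesis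
    by (simp add: push)
qed


section \<open>Symmetric Clifford systems and a smooth retraction onto the focal submanifold\<close>

locale clifford =
  fixes m :: nat and P :: "nat \<Rightarrow> real ^ 'n ^ 'n"
  assumes clifford: "clifford_system m P"
begin

lemma P_adjoint:
  assumes "\<alpha> \<le> m"
  shows "(P \<alpha> *v x) \<bullet> y = x \<bullet> (P \<alpha> *v y)"
proof -
  have "transpose (P \<alpha>) = P \<alpha>"
    using clifford assms by (simp add: clifford_system_def)
  then have "P \<alpha> *v x = x v* P \<alpha>"
    using transpose_matrix_vector [of "P \<alpha>" x] by simp
  then show ?thesis
    by (simp add: dot_lmul_matrix)
qed

lemma P_anticommute:
  assumes "\<alpha> \<le> m" "\<beta> \<le> m"
  shows "P \<alpha> *v (P \<beta> *v x) + P \<beta> *v (P \<alpha> *v x) = (if \<alpha> = \<beta> then 2 *\<^sub>R x else 0)"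
proof -
  have "(P \<alpha> ** P \<beta> + P \<beta> ** P \<alpha>) *v x = ((if \<alpha> = \<beta> then 2 else 0) *\<^sub>R mat 1) *v x"
    using clifford assms by (simp add: clifford_system_def)
  then show ?thesis
    by (simp add: matrix_vector_mult_add_rdistrib matrix_vector_mul_assoc scaleR_matrix_vector_assoc [symmetric]
        split: if_splits)
qed

lemma P_P [simp]: "\<alpha> \<le> m \<Longrightarrow> P \<alpha> *v (P \<alpha> *v x) = x"
  using P_anticommute [of \<alpha> \<alpha> x] by (simp flip: scaleR_2)

lemma P_swap: "\<alpha> \<le> m \<Longrightarrow> \<beta> \<le> m \<Longrightarrow> \<alpha> \<noteq> \<beta> \<Longrightarrow> P \<alpha> *v (P \<beta> *v x) = - (P \<beta> *v (P \<alpha> *v x))"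
  using P_anticommute [of \<alpha> \<beta> x] by (simp add: eq_neg_iff_add_eq_0)

lemma P_isometry: "\<alpha> \<le> m \<Longrightarrow> (P \<alpha> *v x) \<bullet> (P \<alpha> *v y) = x \<bullet> y"
  by (simp add: P_adjoint)

lemma P_inner_P:
  assumes "\<alpha> \<le> m" "\<beta> \<le> m"
  shows "(P \<alpha> *v x) \<bullet> (P \<beta> *v x) = (if \<alpha> = \<beta> then x \<bullet> x else 0)"
proof (cases "\<alpha> = \<beta>")
  case False
  have "(P \<alpha> *v x) \<bullet> (P \<beta> *v x) = x \<bullet> (P \<alpha> *v (P \<beta> *v x))"
    by (rule P_adjoint [OF assms(1)])
  also have "\<dots> = - (x \<bullet> (P \<beta> *v (P \<alpha> *v x)))"
    using P_swap [OF assms False] by simp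
  also have "\<dots> = - ((P \<alpha> *v x) \<bullet> (P \<beta> *v x))"
    using P_adjoint [OF assms(2), of x "P \<alpha> *v x"] by (simp add: inner_commute)
  finally show ?thesis
    using False by simp
qed (use assms in \<open>simp add: P_isometry\<close>)

definition combo :: "(nat \<Rightarrow> real) \<Rightarrow> real ^ 'n \<Rightarrow> real ^ 'n"
  where "combo c x = (\<Sum>\<alpha>\<le>m. c \<alpha> *\<^sub>R (P \<alpha> *v x))"

lemma combo_adjoint: "combo c x \<bullet> y = x \<bullet> combo c y"
  unfolding combo_def inner_sum_left inner_sum_right
  by (rule sum.cong) (simp_all add: P_adjoint)

lemma P_sum: "P \<beta> *v (\<Sum>i\<in>I. f i) = (\<Sum>i\<in>I. P \<beta> *v f i)"
  by (rule linear_sum [OF matrix_vector_mul_linear])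

lemma P_combo:
  assumes "\<beta> \<le> m"
  shows "P \<beta> *v combo c x = (2 * c \<beta>) *\<^sub>R x - combo c (P \<beta> *v x)"
proof -
  have "P \<beta> *v combo c x + combo c (P \<beta> *v x)
      = (\<Sum>\<alpha>\<le>m. c \<alpha> *\<^sub>R (P \<beta> *v (P \<alpha> *v x) + P \<alpha> *v (P \<beta> *v x)))"
    unfolding combo_def P_sum matrix_vector_mult_scaleR scaleR_add_right sum.distrib ..
  also have "\<dots> = (\<Sum>\<alpha>\<le>m. if \<alpha> = \<beta> then (2 * c \<beta>) *\<^sub>R x else 0)"
    by (rule sum.cong) (use assms in \<open>simp_all add: P_anticommute\<close>)
  also have "\<dots> = (2 * c \<beta>) *\<^sub>R x"
    using assms by simp
  finally show ?thesis
    by (simp add: eq_diff_eq)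
qed

text \<open>Moving the outer operator inside by \<open>P_combo\<close> reproduces the left side with the opposite sign.\<close>

lemma combo_combo: "combo c (combo c x) = (\<Sum>\<alpha>\<le>m. (c \<alpha>)\<^sup>2) *\<^sub>R x"
proof -
  have 1: "combo c (combo c x) = (\<Sum>\<alpha>\<le>m. c \<alpha> *\<^sub>R combo c (P \<alpha> *v x))"
  proof -
    have "combo c (combo c x) = (\<Sum>\<alpha>\<le>m. \<Sum>\<beta>\<le>m. c \<alpha> *\<^sub>R c \<beta> *\<^sub>R (P \<alpha> *v (P \<beta> *v x)))"
      by (simp only: combo_def P_sum matrix_vector_mult_scaleR scaleR_sum_right)
    also have "\<dots> = (\<Sum>\<beta>\<le>m. \<Sum>\<alpha>\<le>m. c \<alpha> *\<^sub>R c \<beta> *\<^sub>R (P \<alpha> *v (P \<beta> *v x)))"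
      by (rule sum.swap)
    also have "\<dots> = (\<Sum>\<beta>\<le>m. c \<beta> *\<^sub>R combo c (P \<beta> *v x))"
      unfolding combo_def scaleR_sum_right
      by (intro sum.cong refl) (rule scaleR_left_commute)
    finally show ?thesis .
  qed
  have "combo c (combo c x) = (\<Sum>\<alpha>\<le>m. c \<alpha> *\<^sub>R (P \<alpha> *v combo c x))"
    by (rule combo_def)
  also have "\<dots> = (\<Sum>\<alpha>\<le>m. (2 * (c \<alpha>)\<^sup>2) *\<^sub>R x - c \<alpha> *\<^sub>R combo c (P \<alpha> *v x))"
    by (rule sum.cong) (simp_all add: P_combo scaleR_diff_right power2_eq_square mult.left_commute)
  also have "\<dots> = (\<Sum>\<alpha>\<le>m. 2 * (c \<alpha>)\<^sup>2) *\<^sub>R x - combo c (combo c x)"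
    by (simp only: sum_subtractf scaleR_sum_left 1)
  finally have "2 *\<^sub>R combo c (combo c x) = 2 *\<^sub>R ((\<Sum>\<alpha>\<le>m. (c \<alpha>)\<^sup>2) *\<^sub>R x)"
    by (simp add: scaleR_2 [of "combo c (combo c x)"] eq_diff_eq flip: sum_distrib_left)
  then show ?thesis
    by (simp only: scaleR_cancel_left) simp
qed

definition height :: "real ^ 'n \<Rightarrow> nat \<Rightarrow> real"
  where "height x \<alpha> = (P \<alpha> *v x) \<bullet> x"

text \<open>The retraction first moves \<open>x\<close> to \<open>y = x + s H x\<close>, where \<open>H = \<Sum>\<^sub>\<alpha> h\<^sub>\<alpha> P\<^sub>\<alpha>\<close> and \<open>h\<^sub>\<alpha> = (P\<^sub>\<alpha> x) \<bullet> x\<close>. By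
  \<open>height_push\<close> the new heights are the old ones times the common factor
  \<open>1 + 2 s \<bar>x\<bar>\<^sup>2 + s\<^sup>2 \<Sum>\<^sub>\<alpha> h\<^sub>\<alpha>\<^sup>2\<close>. The root of this quadratic in \<open>s\<close> that stays finite as the heights tend
  to zero is \<open>push_coeff x\<close>, and \<open>discr x\<close> is its reduced discriminant. The result lies on the cone over \<open>M\<^sub>1\<close> and is
  then normalised.\<close>

definition discr :: "real ^ 'n \<Rightarrow> real"
  where "discr x = (x \<bullet> x) * (x \<bullet> x) - (\<Sum>\<alpha>\<le>m. height x \<alpha> * height x \<alpha>)"

definition push_coeff :: "real ^ 'n \<Rightarrow> real"
  where "push_coeff x = - 1 * (x \<bullet> x + discr x powr (1/2)) powr (-1)"

definition to_cone :: "real ^ 'n \<Rightarrow> real ^ 'n"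
  where "to_cone x = x + push_coeff x *\<^sub>R combo (height x) x"

definition retract :: "real ^ 'n \<Rightarrow> real ^ 'n"
  where "retract x = ((to_cone x \<bullet> to_cone x) powr (-1/2)) *\<^sub>R to_cone x"

text \<open>The linear term in \<open>s\<close> uses that the vectors \<open>P\<^sub>\<alpha> x\<close> are orthogonal and have the length of \<open>x\<close>, the
  quadratic term uses the relation \<open>P\<^sub>\<beta> H = 2 h\<^sub>\<beta> - H P\<^sub>\<beta>\<close>.\<close>

lemma height_push:
  assumes "\<beta> \<le> m"
  shows "height (x + s *\<^sub>R combo (height x) x) \<beta>
    = height x \<beta> * (1 + 2 * s * (x \<bullet> x) + s\<^sup>2 * (\<Sum>\<alpha>\<le>m. (height x \<alpha>)\<^sup>2))"
proof -
  let ?h = "height x" and ?\<eta> = "\<Sum>\<alpha>\<le>m. (height x \<alpha>)\<^sup>2"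
  let ?v = "combo ?h x"
  have 1: "(P \<beta> *v x) \<bullet> ?v = ?h \<beta> * (x \<bullet> x)"
  proof -
    have "(P \<beta> *v x) \<bullet> ?v = (\<Sum>\<alpha>\<le>m. if \<alpha> = \<beta> then ?h \<beta> * (x \<bullet> x) else 0)"
      unfolding combo_def inner_sum_right
      by (rule sum.cong) (use assms in \<open>auto simp: P_inner_P\<close>)
    then show ?thesis
      using assms by simp
  qed
  have 2: "x \<bullet> ?v = ?\<eta>"
    by (simp add: combo_def inner_sum_right height_def power2_eq_square inner_commute)
  have "(P \<beta> *v ?v) \<bullet> ?v = 2 * ?h \<beta> * (x \<bullet> ?v) - (P \<beta> *v x) \<bullet> combo ?h ?v"
    by (simp add: P_combo assms inner_diff_left combo_adjoint)
  then have 3: "(P \<beta> *v ?v) \<bullet> ?v = ?h \<beta> * ?\<eta>"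
    by (simp add: combo_combo 2 height_def)
  have 4: "(P \<beta> *v ?v) \<bullet> x = (P \<beta> *v x) \<bullet> ?v"
    by (subst P_adjoint [OF assms]) (rule inner_commute)
  have "height (x + s *\<^sub>R ?v) \<beta> = ?h \<beta> + 2 * s * ((P \<beta> *v x) \<bullet> ?v) + s\<^sup>2 * ((P \<beta> *v ?v) \<bullet> ?v)"
    by (simp add: height_def matrix_vector_right_distrib matrix_vector_mult_scaleR inner_add_left
        inner_add_right 4 power2_eq_square algebra_simps)
  then show ?thesis
    by (simp add: 1 3 algebra_simps)
qed

lemma height_to_cone:
  assumes "\<beta> \<le> m" "discr x > 0"
  shows "height (to_cone x) \<beta> = 0"
proof -
  define \<eta> n d where "\<eta> = (\<Sum>\<alpha>\<le>m. (height x \<alpha>)\<^sup>2)" and "n = x \<bullet> x" and "d = discr x powr (1/2)"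
  have d: "d > 0" "d\<^sup>2 = n\<^sup>2 - \<eta>"
    using assms(2) by (simp_all add: d_def powr_half_sqrt) (simp add: discr_def n_def \<eta>_def power2_eq_square)
  have n: "n \<ge> 0"
    by (simp add: n_def)
  have s: "push_coeff x = - (1 / (n + d))"
    using d n by (simp add: push_coeff_def n_def d_def powr_minus_divide)
  have "1 + 2 * push_coeff x * n + (push_coeff x)\<^sup>2 * \<eta> = ((n + d)\<^sup>2 - 2 * n * (n + d) + \<eta>) / (n + d)\<^sup>2"
  proof -
    have "1 + 2 * (- (1 / t)) * n + (- (1 / t))\<^sup>2 * \<eta> = (t\<^sup>2 - 2 * n * t + \<eta>) / t\<^sup>2" if "t > 0" for t
      using that by (simp add: field_simps power2_eq_square)
    from this [of "n + d"] show ?thesis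
      using d n by (simp add: s)
  qed
  also have "(n + d)\<^sup>2 - 2 * n * (n + d) + \<eta> = 0"
    using d(2) by (simp add: power2_eq_square algebra_simps)
  finally show ?thesis
    by (simp add: to_cone_def height_push assms(1) n_def \<eta>_def)
qed

lemma retract_in_focal:
  assumes "discr x > 0" "to_cone x \<bullet> to_cone x > 0"
  shows "retract x \<in> focal_M1 m P"
proof -
  let ?y = "to_cone x"
  let ?q = "(?y \<bullet> ?y) powr (-1/2)"
  have "?q * ?q = (?y \<bullet> ?y) powr (-1)"
    by (simp flip: powr_add)
  then have q: "?q * ?q * (?y \<bullet> ?y) = 1"
    using assms(2) by (simp add: powr_minus_divide)
  then have "retract x \<bullet> retract x = 1"
    by (simp add: retract_def mult.assoc)
  moreover have "(P \<beta> *v retract x) \<bullet> retract x = 0" if "\<beta> \<le> m" for \<beta>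
    using height_to_cone [OF that assms(1)]
    by (simp add: retract_def height_def matrix_vector_mult_scaleR)
  ultimately show ?thesis
    by (simp add: focal_M1_eq norm_eq_1)
qed

lemma focal_unit: "p \<in> focal_M1 m P \<Longrightarrow> p \<bullet> p = 1"
  by (simp add: focal_M1_eq norm_eq_1)

lemma focal_height: "p \<in> focal_M1 m P \<Longrightarrow> \<alpha> \<le> m \<Longrightarrow> (P \<alpha> *v p) \<bullet> p = 0"
  by (simp add: focal_M1_eq)

definition tangent :: "real ^ 'n \<Rightarrow> real ^ 'n \<Rightarrow> bool"
  where "tangent p a \<longleftrightarrow> a \<bullet> p = 0 \<and> (\<forall>\<alpha>\<le>m. a \<bullet> (P \<alpha> *v p) = 0)"

lemma bounded_linear_P: "bounded_linear (\<lambda>x. P \<alpha> *v x)"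
  by (rule linear_linear [THEN iffD2, OF matrix_vector_mul_linear])

text \<open>Near \<open>p\<close> the map \<open>retract\<close> is built from polynomials and real powers of positive functions. Its
  derivative at \<open>p\<close> fixes tangent vectors: along them the heights vanish to first order, so
  \<open>to_cone\<close> has derivative \<open>a\<close>, and the normalising factor can add only a multiple of \<open>p\<close>, which
  vanishes as the image lies in the unit sphere.\<close>

lemma local_retraction:
  assumes "p \<in> focal_M1 m P"
  obtains U X where "open U" "p \<in> U" "Cinf_on U X" "X ` U \<subseteq> focal_M1 m P" "X p = p"
    "\<And>a. tangent p a \<Longrightarrow> dir_deriv a X p = a"
proof -
  have id_Cinf: "Cinf_on U (\<lambda>x::real^'n. x)" if "open U" for U
    by (rule Cinf_on_bounded_linear [OF bounded_linear_ident that])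
  have P_Cinf: "Cinf_on U (\<lambda>x. P \<alpha> *v x)" if "open U" for U \<alpha>
    by (rule Cinf_on_bounded_linear [OF bounded_linear_P that])
  have height_Cinf: "Cinf_on U (\<lambda>x. height x \<alpha>)" if "open U" for U \<alpha>
    unfolding height_def by (intro Cinf_on_inner P_Cinf id_Cinf that)
  have minus: "a - b = a + (- 1) * b" for a b :: real
    by simp
  have discr_Cinf: "Cinf_on U discr" if "open U" for U
    unfolding discr_def [abs_def] minus
    by (intro Cinf_on_add Cinf_on_mult Cinf_on_sum Cinf_on_const Cinf_on_inner height_Cinf id_Cinf that)
  \<comment> \<open>Here the root in \<open>push_coeff\<close> is smooth and its denominator is positive.\<close>
  define V where "V = {x. discr x > 0}"
  have "open V"
    unfolding V_def
    by (rule open_Collect_less [OF continuous_on_const Cinf_on_continuous [OF discr_Cinf [OF open_UNIV]]])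
  have root_Cinf: "Cinf_on V (\<lambda>x. discr x powr (1/2))"
    by (rule Cinf_on_powr [OF \<open>open V\<close> discr_Cinf [OF \<open>open V\<close>]]) (simp add: V_def)
  have push_coeff_Cinf: "Cinf_on V push_coeff"
    unfolding push_coeff_def [abs_def]
    by (intro Cinf_on_mult Cinf_on_const \<open>open V\<close> Cinf_on_powr Cinf_on_add Cinf_on_inner id_Cinf root_Cinf)
      (auto simp: V_def intro: add_nonneg_pos)
  have cone_Cinf: "Cinf_on V to_cone"
    unfolding to_cone_def [abs_def] combo_def
    by (intro Cinf_on_add Cinf_on_scaleR Cinf_on_sum id_Cinf push_coeff_Cinf height_Cinf P_Cinf \<open>open V\<close>)
  define U where "U = V \<inter> {x. to_cone x \<bullet> to_cone x > 0}"
  have sq_Cinf: "Cinf_on V (\<lambda>x. to_cone x \<bullet> to_cone x)"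
    by (intro Cinf_on_inner cone_Cinf \<open>open V\<close>)
  have "U = V \<inter> (\<lambda>x. to_cone x \<bullet> to_cone x) -` {0<..}"
    by (auto simp: U_def)
  then have "open U"
    using continuous_open_preimage [OF Cinf_on_continuous [OF sq_Cinf] \<open>open V\<close> open_greaterThan [of 0]] by simp
  have "U \<subseteq> V"
    by (simp add: U_def)
  note sub = Cinf_on_subset [OF \<open>open V\<close> \<open>open U\<close> \<open>U \<subseteq> V\<close>]
  have norm_Cinf: "Cinf_on U (\<lambda>x. (to_cone x \<bullet> to_cone x) powr (-1/2))"
    by (rule Cinf_on_powr [OF \<open>open U\<close> sub [OF sq_Cinf]]) (simp add: U_def)
  have X_Cinf: "Cinf_on U retract"
    unfolding retract_def [abs_def] by (intro Cinf_on_scaleR norm_Cinf sub cone_Cinf \<open>open U\<close>)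
  have X_in: "retract ` U \<subseteq> focal_M1 m P"
    using retract_in_focal by (auto simp: U_def V_def)
  have h0: "height p \<alpha> = 0" if "\<alpha> \<le> m" for \<alpha>
    using focal_height [OF assms that] by (simp add: height_def)
  have cone_p: "to_cone p = p"
    by (simp add: to_cone_def combo_def h0)
  have "discr p = 1"
    using focal_unit [OF assms] by (simp add: discr_def h0)
  then have "p \<in> U" "p \<in> V"
    using focal_unit [OF assms] by (auto simp: U_def V_def cone_p)
  have X_p: "retract p = p"
    using focal_unit [OF assms] by (simp add: retract_def cone_p)
  have tan: "dir_deriv a retract p = a" if "tangent p a" for a
  proof -
    have prod: "dir_deriv a (\<lambda>x. f x *\<^sub>R g x) p = f p *\<^sub>R dir_deriv a g p + dir_deriv a f p *\<^sub>R g p"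
      if "f differentiable (at p)" "g differentiable (at p)" for f :: "real^'n \<Rightarrow> real" and g :: "real^'n \<Rightarrow> real^'n"
      by (rule dir_deriv_eqI, rule has_derivative_scaleR) (intro has_derivative_dir_deriv that)+
    have dP: "dir_deriv a (\<lambda>x. P \<alpha> *v x) p = P \<alpha> *v a" for \<alpha>
      by (rule dir_deriv_eqI) (rule bounded_linear_imp_has_derivative [OF bounded_linear_P])
    have dI: "dir_deriv a (\<lambda>x. x) p = a"
      by (rule dir_deriv_eqI [where f' = "\<lambda>x. x"]) simp
    have dh: "dir_deriv a (\<lambda>x. height x \<alpha>) p = 0" if "\<alpha> \<le> m" for \<alpha>
    proof -
      have "dir_deriv a (\<lambda>x. height x \<alpha>) p = (P \<alpha> *v a) \<bullet> p + (P \<alpha> *v p) \<bullet> a"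
        unfolding height_def
        by (simp add: dir_deriv_inner_Cinf [OF \<open>open V\<close> P_Cinf id_Cinf] \<open>open V\<close> \<open>p \<in> V\<close> dP dI)
      then show ?thesis
        using \<open>tangent p a\<close> that P_adjoint [OF that, of a p] inner_commute [of "P \<alpha> *v p" a]
        by (simp add: tangent_def)
    qed
    note diff = Cinf_on_differentiable [OF \<open>open V\<close> _ \<open>p \<in> V\<close>]
    have term_diff: "(\<lambda>x. height x \<alpha> *\<^sub>R (P \<alpha> *v x)) differentiable (at p)" for \<alpha>
      by (intro diff Cinf_on_scaleR height_Cinf P_Cinf \<open>open V\<close>)
    have dterm: "dir_deriv a (\<lambda>x. height x \<alpha> *\<^sub>R (P \<alpha> *v x)) p = 0" if "\<alpha> \<le> m" for \<alpha>
      by (simp add: prod diff height_Cinf P_Cinf \<open>open V\<close> dh h0 that)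
    have sum_diff: "(\<lambda>x. combo (height x) x) differentiable (at p)"
      unfolding combo_def by (intro diff Cinf_on_sum Cinf_on_scaleR height_Cinf P_Cinf \<open>open V\<close>)
    have "((\<lambda>x. combo (height x) x) has_derivative
        (\<lambda>v. \<Sum>\<alpha>\<le>m. dir_deriv v (\<lambda>x. height x \<alpha> *\<^sub>R (P \<alpha> *v x)) p)) (at p)"
      unfolding combo_def by (intro has_derivative_sum has_derivative_dir_deriv term_diff)
    then have dsum: "dir_deriv a (\<lambda>x. combo (height x) x) p = 0"
      by (simp add: dir_deriv_eqI dterm)
    have cdiff: "push_coeff differentiable (at p)"
      by (rule diff [OF push_coeff_Cinf])
    have "dir_deriv a (\<lambda>x. push_coeff x *\<^sub>R combo (height x) x) p = 0"
      by (simp add: prod cdiff sum_diff dsum) (simp add: combo_def h0)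
    moreover have "(to_cone has_derivative
        (\<lambda>v. v + dir_deriv v (\<lambda>x. push_coeff x *\<^sub>R combo (height x) x) p)) (at p)"
      unfolding to_cone_def [abs_def]
      by (intro has_derivative_add has_derivative_ident has_derivative_dir_deriv
          differentiable_scaleR cdiff sum_diff)
    ultimately have dcone: "dir_deriv a to_cone p = a"
      by (simp add: dir_deriv_eqI)
    let ?q = "\<lambda>x. (to_cone x \<bullet> to_cone x) powr (-1/2)"
    have qdiff: "?q differentiable (at p)"
      by (rule Cinf_on_differentiable [OF \<open>open U\<close> norm_Cinf \<open>p \<in> U\<close>])
    have eq: "dir_deriv a retract p = a + dir_deriv a ?q p *\<^sub>R p"
      using prod [OF qdiff diff [OF cone_Cinf]] focal_unit [OF assms]
      by (simp add: retract_def [abs_def] cone_p dcone)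
    have "dir_deriv a retract p \<bullet> retract p = 0"
      by (rule level_set_first_order [OF \<open>open U\<close> X_Cinf bounded_linear_ident, where c = 1])
        (use X_in focal_unit \<open>p \<in> U\<close> in auto)
    \<comment> \<open>Both \<open>a\<close> and the derivative of the retraction are orthogonal to \<open>p\<close>.\<close>
    then have "dir_deriv a ?q p = 0"
      using that focal_unit [OF assms] by (simp add: eq X_p inner_add_left tangent_def)
    then show ?thesis
      by (simp add: eq)
  qed
  show thesis
    by (rule that [OF \<open>open U\<close> \<open>p \<in> U\<close> X_Cinf X_in X_p tan])
qed

end


section \<open>Isometry invariance of the Ricci form\<close>

lemma orthonormal_parseval:
  fixes C :: "'a::euclidean_space set"
  assumes "pairwise orthogonal C" "\<And>c. c \<in> C \<Longrightarrow> norm c = 1" "card C = DIM('a)"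
  shows "u \<bullet> v = (\<Sum>c\<in>C. (u \<bullet> c) * (v \<bullet> c))"
proof -
  have "independent C"
    using assms(1) assms(2) [of 0] by (intro pairwise_orthogonal_independent) auto
  then have "span C = UNIV"
    using assms(3) by (metis dim_eq_card dim_eq_full)
  moreover have "finite C"
    using assms(3) by (intro card_ge_0_finite) simp
  ultimately have "(\<Sum>c\<in>C. (u \<bullet> c) *\<^sub>R c) = u"
    using orthonormal_basis_expand [OF assms(1,2), of u] by simp
  then have "u \<bullet> v = (\<Sum>c\<in>C. (u \<bullet> c) *\<^sub>R c) \<bullet> v"
    by simp
  also have "\<dots> = (\<Sum>c\<in>C. (u \<bullet> c) * (v \<bullet> c))"
    unfolding inner_sum_left inner_scaleR_left by (simp only: inner_commute [of v])
  finally show ?thesis .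
qed

lemma trace_orthonormal:
  fixes C :: "'a::euclidean_space set"
  assumes "pairwise orthogonal C" "\<And>c. c \<in> C \<Longrightarrow> norm c = 1" "card C = DIM('a)"
    and A: "\<And>u v. A u \<bullet> v = u \<bullet> A v"
  shows "(\<Sum>c\<in>C. A c \<bullet> c) = (\<Sum>b\<in>Basis. A b \<bullet> b)"
proof -
  have "(\<Sum>c\<in>C. A c \<bullet> c) = (\<Sum>c\<in>C. \<Sum>b\<in>Basis. (A c \<bullet> b) * (c \<bullet> b))"
    by (rule sum.cong [OF refl]) (rule euclidean_inner)
  also have "\<dots> = (\<Sum>b\<in>Basis. \<Sum>c\<in>C. (A b \<bullet> c) * (b \<bullet> c))"
    by (subst sum.swap, intro sum.cong refl) (subst A, simp only: inner_commute)
  also have "\<dots> = (\<Sum>b\<in>Basis. A b \<bullet> b)"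
    by (rule sum.cong [OF refl]) (rule orthonormal_parseval [OF assms(1-3), symmetric])
  finally show ?thesis .
qed

context clifford
begin

text \<open>The tangent space of \<open>M\<^sub>1\<close> at \<open>p\<close> is the orthogonal complement of the \<open>m + 2\<close> orthonormal vectors \<open>p\<close>
  and \<open>P\<^sub>\<alpha> p\<close>, so a tangent orthonormal set with \<open>CARD('n) - (m + 2)\<close> elements is a basis. Stated
  by a count, the property transfers along injective isometric maps.\<close>

definition tangent_frame :: "real ^ 'n \<Rightarrow> (real ^ 'n) set \<Rightarrow> bool"
  where "tangent_frame p B \<longleftrightarrow> (\<forall>e\<in>B. tangent p e \<and> norm e = 1) \<and> pairwise orthogonal B
    \<and> finite B \<and> card B + (m + 2) = CARD('n)"

definition normals :: "real ^ 'n \<Rightarrow> (real ^ 'n) set"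
  where "normals p = insert p ((\<lambda>\<alpha>. P \<alpha> *v p) ` {..m})"

lemma normals_sum:
  assumes "p \<in> focal_M1 m P"
  shows "(\<Sum>c\<in>normals p. f c) = f p + (\<Sum>\<alpha>\<le>m. f (P \<alpha> *v p))"
    and "card (normals p) = m + 2"
proof -
  have inj: "inj_on (\<lambda>\<alpha>. P \<alpha> *v p) {..m}"
  proof (rule inj_onI)
    fix \<alpha> \<beta> assume *: "\<alpha> \<in> {..m}" "\<beta> \<in> {..m}" "P \<alpha> *v p = P \<beta> *v p"
    then show "\<alpha> = \<beta>"
      using P_inner_P [of \<alpha> \<beta> p] P_inner_P [of \<beta> \<beta> p] focal_unit [OF assms]
      by (auto split: if_splits)
  qed
  have notin: "p \<notin> (\<lambda>\<alpha>. P \<alpha> *v p) ` {..m}"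
    using focal_unit [OF assms] focal_height [OF assms] by force
  show "(\<Sum>c\<in>normals p. f c) = f p + (\<Sum>\<alpha>\<le>m. f (P \<alpha> *v p))"
    using notin by (simp add: normals_def sum.reindex [OF inj])
  show "card (normals p) = m + 2"
    using notin by (simp add: normals_def card_image [OF inj])
qed

lemma normals_orthonormal:
  assumes "p \<in> focal_M1 m P"
  shows "pairwise orthogonal (normals p)" "\<And>c. c \<in> normals p \<Longrightarrow> norm c = 1"
proof -
  show "pairwise orthogonal (normals p)"
    using focal_height [OF assms]
    by (auto simp: normals_def pairwise_def orthogonal_def P_inner_P inner_commute [of p "_ *v p"])
  show "norm c = 1" if "c \<in> normals p" for c
    using that focal_unit [OF assms] by (auto simp: normals_def norm_eq_1 P_isometry)
qed

lemma full_frame: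
  assumes "p \<in> focal_M1 m P" "tangent_frame p B"
  shows "pairwise orthogonal (normals p \<union> B)" "\<And>c. c \<in> normals p \<union> B \<Longrightarrow> norm c = 1"
    "card (normals p \<union> B) = DIM(real ^ 'n)"
    "(\<Sum>c\<in>normals p \<union> B. f c) = f p + (\<Sum>\<alpha>\<le>m. f (P \<alpha> *v p)) + (\<Sum>e\<in>B. f e)"
proof -
  have orth: "e \<bullet> c = 0" if "e \<in> B" "c \<in> normals p" for e c
    using that assms(2) by (auto simp: tangent_frame_def tangent_def normals_def)
  have orth': "c \<bullet> e = 0" if "e \<in> B" "c \<in> normals p" for e c
    using orth [OF that] by (simp add: inner_commute)
  have disj: "normals p \<inter> B = {}"
    using orth normals_orthonormal(2) [OF assms(1)] by fastforce
  have fin: "finite (normals p)" "finite B"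
    using assms(2) by (auto simp: normals_def tangent_frame_def)
  show "pairwise orthogonal (normals p \<union> B)"
    using normals_orthonormal(1) [OF assms(1)] assms(2) orth orth'
    by (auto simp: pairwise_def tangent_frame_def orthogonal_def)
  show "norm c = 1" if "c \<in> normals p \<union> B" for c
    using that normals_orthonormal(2) [OF assms(1)] assms(2) by (auto simp: tangent_frame_def)
  show "card (normals p \<union> B) = DIM(real ^ 'n)"
    using assms(2) normals_sum(2) [OF assms(1)] by (simp add: card_Un_disjoint fin disj tangent_frame_def)
  show "(\<Sum>c\<in>normals p \<union> B. f c) = f p + (\<Sum>\<alpha>\<le>m. f (P \<alpha> *v p)) + (\<Sum>e\<in>B. f e)"
    using normals_sum(1) [OF assms(1), of f] by (simp add: sum.union_disjoint fin disj)
qed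

lemma tangent_frame_parseval:
  assumes "p \<in> focal_M1 m P" "tangent_frame p B"
  shows "u \<bullet> v = (u \<bullet> p) * (v \<bullet> p) + (\<Sum>\<alpha>\<le>m. (u \<bullet> (P \<alpha> *v p)) * (v \<bullet> (P \<alpha> *v p)))
    + (\<Sum>e\<in>B. (u \<bullet> e) * (v \<bullet> e))"
  using orthonormal_parseval [OF full_frame(1-3) [OF assms], of u v] unfolding full_frame(4) [OF assms] .

lemma tangent_frame_exists:
  assumes "p \<in> focal_M1 m P"
  obtains B where "tangent_frame p B"
proof -
  let ?N = "span (normals p)"
  let ?T = "{y \<in> UNIV. \<forall>x\<in>?N. orthogonal x y}"
  have "independent (normals p)"
    using normals_orthonormal(1) [OF assms] normals_orthonormal(2) [OF assms, of 0]
    by (intro pairwise_orthogonal_independent) auto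
  then have "dim ?N = m + 2"
    using normals_sum(2) [OF assms] by (simp add: dim_eq_card_independent)
  then have dim: "dim ?T + (m + 2) = CARD('n)"
    using dim_subspace_orthogonal_to_vectors [of ?N UNIV] by simp
  have "subspace ?T"
    by (auto simp: subspace_def orthogonal_def inner_add_right)
  then obtain B where B: "B \<subseteq> ?T" "pairwise orthogonal B" "\<And>x. x \<in> B \<Longrightarrow> norm x = 1"
    "independent B" "card B = dim ?T" "span B = ?T"
    using orthonormal_basis_subspace by blast
  have "tangent p e" if "e \<in> B" for e
  proof -
    have "orthogonal c e" if "c \<in> normals p" for c
      using B(1) \<open>e \<in> B\<close> that span_base by blast
    then show ?thesis
      by (simp add: tangent_def normals_def orthogonal_def inner_commute [of e])
  qed
  then have "tangent_frame p B"
    using B(2,3,5) dim independent_imp_finite [OF B(4)] by (simp add: tangent_frame_def)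
  then show thesis
    using that by blast
qed

text \<open>Another \<open>P\<^sub>\<beta>\<close> conjugates \<open>P\<^sub>\<alpha>\<close> to \<open>- P\<^sub>\<alpha>\<close> and maps orthonormal bases to orthonormal bases.\<close>

lemma trace_P:
  assumes "\<alpha> \<le> m" "\<beta> \<le> m" "\<alpha> \<noteq> \<beta>"
  shows "(\<Sum>b\<in>Basis. (P \<alpha> *v b) \<bullet> b) = 0"
proof -
  let ?\<tau> = "\<Sum>b\<in>Basis. (P \<alpha> *v b) \<bullet> b" and ?C = "(\<lambda>x. P \<beta> *v x) ` Basis"
  have inj: "inj_on (\<lambda>x. P \<beta> *v x) Basis"
    using P_P [OF assms(2)] by (metis inj_on_def)
  have "(\<Sum>c\<in>?C. (P \<alpha> *v c) \<bullet> c) = ?\<tau>"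
  proof (rule trace_orthonormal)
    show "pairwise orthogonal ?C"
      using inner_not_same_Basis by (auto simp: pairwise_def orthogonal_def P_isometry [OF assms(2)])
    show "norm c = 1" if "c \<in> ?C" for c
      using that by (auto simp: norm_eq_1 P_isometry [OF assms(2)])
    show "card ?C = DIM(real ^ 'n)"
      by (simp only: card_image [OF inj])
  qed (rule P_adjoint [OF assms(1)])
  moreover have "(\<Sum>c\<in>?C. (P \<alpha> *v c) \<bullet> c) = (\<Sum>b\<in>Basis. - ((P \<alpha> *v b) \<bullet> b))"
    by (simp only: sum.reindex [OF inj] o_def P_swap [OF assms] inner_minus_left P_isometry [OF assms(2)])
  ultimately have "?\<tau> = - ?\<tau>"
    by (simp only: sum_negf)
  then show ?thesis
    by simp
qed

text \<open>Minimality of \<open>M\<^sub>1\<close>: the trace of \<open>P\<^sub>\<alpha>\<close> over the whole space vanishes, and so does each diagonal entry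
  at the vectors \<open>p\<close> and \<open>P\<^sub>\<beta> p\<close>.\<close>

lemma trace_tangent:
  assumes "p \<in> focal_M1 m P" "tangent_frame p B" "\<alpha> \<le> m" "m \<noteq> 0"
  shows "(\<Sum>e\<in>B. (P \<alpha> *v e) \<bullet> e) = 0"
proof -
  obtain \<gamma> where \<gamma>: "\<gamma> \<le> m" "\<alpha> \<noteq> \<gamma>"
    using assms(3,4) by (metis zero_le order_refl)
  have "(\<Sum>c\<in>normals p \<union> B. (P \<alpha> *v c) \<bullet> c) = 0"
    using trace_orthonormal [OF full_frame(1-3) [OF assms(1,2)] P_adjoint [OF assms(3)]]
      trace_P [OF assms(3) \<gamma>] by simp
  then have "(P \<alpha> *v p) \<bullet> p + (\<Sum>\<beta>\<le>m. (P \<alpha> *v (P \<beta> *v p)) \<bullet> (P \<beta> *v p))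
      + (\<Sum>e\<in>B. (P \<alpha> *v e) \<bullet> e) = 0"
    by (simp only: full_frame(4) [OF assms(1,2)])
  moreover have "(P \<alpha> *v (P \<beta> *v p)) \<bullet> (P \<beta> *v p) = 0" if "\<beta> \<le> m" for \<beta>
  proof (cases "\<alpha> = \<beta>")
    case True
    then show ?thesis
      using focal_height [OF assms(1) that] that by (simp add: inner_commute)
  next
    case False
    then show ?thesis
      using focal_height [OF assms(1,3)] that assms(3) by (simp add: P_swap [of \<alpha> \<beta>] P_isometry)
  qed
  ultimately show ?thesis
    using focal_height [OF assms(1,3)] by simp
qed

text \<open>For tangent \<open>a\<close> this is the Ricci form of \<open>M\<^sub>1\<close> up to a constant multiple of \<open>a \<bullet> a\<close>.\<close>

definition ricci_form :: "real ^ 'n \<Rightarrow> real ^ 'n \<Rightarrow> real"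
  where "ricci_form p a = (\<Sum>\<alpha>\<le>m. \<Sum>\<beta>\<le>m. ((P \<alpha> *v a) \<bullet> (P \<beta> *v p))\<^sup>2)"

text \<open>The left side is the trace of the extrinsic part of the Gauss equation. Its first term vanishes since
  \<open>M\<^sub>1\<close> is minimal. In the second, the sum over \<open>B\<close> is the squared length of \<open>P\<^sub>\<alpha> a\<close> minus that of its
  normal part.\<close>

lemma ricci_form_eq:
  assumes "p \<in> focal_M1 m P" "tangent_frame p B" "tangent p a" "m \<noteq> 0"
  shows "(\<Sum>e\<in>B. \<Sum>\<alpha>\<le>m. ((P \<alpha> *v a) \<bullet> a) * ((P \<alpha> *v e) \<bullet> e) - ((P \<alpha> *v a) \<bullet> e)\<^sup>2)
    = ricci_form p a - real (m + 1) * (a \<bullet> a)"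
proof -
  have "(\<Sum>e\<in>B. \<Sum>\<alpha>\<le>m. ((P \<alpha> *v a) \<bullet> a) * ((P \<alpha> *v e) \<bullet> e) - ((P \<alpha> *v a) \<bullet> e)\<^sup>2)
    = (\<Sum>\<alpha>\<le>m. ((P \<alpha> *v a) \<bullet> a) * (\<Sum>e\<in>B. (P \<alpha> *v e) \<bullet> e) - (\<Sum>e\<in>B. ((P \<alpha> *v a) \<bullet> e)\<^sup>2))"
    by (subst sum.swap) (simp add: sum_subtractf sum_distrib_left)
  also have "\<dots> = (\<Sum>\<alpha>\<le>m. (\<Sum>\<beta>\<le>m. ((P \<alpha> *v a) \<bullet> (P \<beta> *v p))\<^sup>2) - a \<bullet> a)"
  proof (rule sum.cong [OF refl])
    fix \<alpha> assume "\<alpha> \<in> {..m}"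
    then have \<alpha>: "\<alpha> \<le> m"
      by simp
    have "(P \<alpha> *v a) \<bullet> p = 0"
      using assms(3) \<alpha> P_adjoint [OF \<alpha>, of a p] by (simp add: tangent_def)
    then show "((P \<alpha> *v a) \<bullet> a) * (\<Sum>e\<in>B. (P \<alpha> *v e) \<bullet> e) - (\<Sum>e\<in>B. ((P \<alpha> *v a) \<bullet> e)\<^sup>2)
        = (\<Sum>\<beta>\<le>m. ((P \<alpha> *v a) \<bullet> (P \<beta> *v p))\<^sup>2) - a \<bullet> a"
      using tangent_frame_parseval [OF assms(1,2), of "P \<alpha> *v a" "P \<alpha> *v a"]
        trace_tangent [OF assms(1,2) \<alpha> assms(4)] P_isometry [OF \<alpha>, of a a]
      by (simp add: power2_eq_square)
  qed
  finally show ?thesis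
    by (simp add: ricci_form_def sum_subtractf)
qed

lemma focal_second_order:
  assumes "open U" "Cinf_on U X" "X ` U \<subseteq> focal_M1 m P" "x \<in> U"
  shows "tangent (X x) (dir_deriv a X x)"
    and "dir_deriv a (dir_deriv b X) x \<bullet> X x = - (dir_deriv a X x \<bullet> dir_deriv b X x)"
    and "\<alpha> \<le> m \<Longrightarrow> dir_deriv a (dir_deriv b X) x \<bullet> (P \<alpha> *v X x)
      = - ((P \<alpha> *v dir_deriv a X x) \<bullet> dir_deriv b X x)"
proof -
  have P0: "(P \<alpha> *v X x) \<bullet> X x = 0" if "x \<in> U" "\<alpha> \<le> m" for x \<alpha>
    using focal_height that assms(3) by blast
  have I1: "X x \<bullet> X x = 1" if "x \<in> U" for x
    using focal_unit that assms(3) by blast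
  have "dir_deriv a X x \<bullet> (P \<alpha> *v X x) = 0" if "\<alpha> \<le> m" for \<alpha>
    by (rule level_set_first_order [OF assms(1,2) bounded_linear_P P_adjoint [OF that] P0 [OF _ that] assms(4)])
  moreover have "dir_deriv a X x \<bullet> X x = 0"
    by (rule level_set_first_order [OF assms(1,2) bounded_linear_ident refl I1 assms(4)])
  ultimately show "tangent (X x) (dir_deriv a X x)"
    by (simp add: tangent_def)
  show "dir_deriv a (dir_deriv b X) x \<bullet> X x = - (dir_deriv a X x \<bullet> dir_deriv b X x)"
    by (rule level_set_second_order [OF assms(1,2) bounded_linear_ident refl I1 assms(4)])
  show "dir_deriv a (dir_deriv b X) x \<bullet> (P \<alpha> *v X x)
      = - ((P \<alpha> *v dir_deriv a X x) \<bullet> dir_deriv b X x)" if "\<alpha> \<le> m"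
    by (rule level_set_second_order [OF assms(1,2) bounded_linear_P P_adjoint [OF that] P0 [OF _ that] assms(4)])
qed

text \<open>Inner products of second derivatives are expanded in the frame made of \<open>X x\<close>, the \<open>P\<^sub>\<alpha> (X x)\<close> and
  \<open>B\<close>. The normal components come from \<open>focal_second_order\<close>; the last sum is the tangential part.\<close>

lemma gauss_split:
  assumes "open U" "Cinf_on U X" "X ` U \<subseteq> focal_M1 m P" "x \<in> U" "tangent_frame (X x) B"
  shows "dir_deriv a (dir_deriv a X) x \<bullet> dir_deriv b (dir_deriv b X) x
        - dir_deriv a (dir_deriv b X) x \<bullet> dir_deriv a (dir_deriv b X) x
    = (dir_deriv a X x \<bullet> dir_deriv a X x) * (dir_deriv b X x \<bullet> dir_deriv b X x)
      - (dir_deriv a X x \<bullet> dir_deriv b X x)\<^sup>2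
      + (\<Sum>\<alpha>\<le>m. ((P \<alpha> *v dir_deriv a X x) \<bullet> dir_deriv a X x) * ((P \<alpha> *v dir_deriv b X x) \<bullet> dir_deriv b X x)
          - ((P \<alpha> *v dir_deriv a X x) \<bullet> dir_deriv b X x)\<^sup>2)
      + (\<Sum>e\<in>B. (dir_deriv a (dir_deriv a X) x \<bullet> e) * (dir_deriv b (dir_deriv b X) x \<bullet> e)
          - (dir_deriv a (dir_deriv b X) x \<bullet> e)\<^sup>2)"
proof -
  have "X x \<in> focal_M1 m P"
    using assms(3,4) by blast
  note parseval = tangent_frame_parseval [OF this assms(5)]
  show ?thesis
    unfolding parseval [of "dir_deriv a (dir_deriv a X) x" "dir_deriv b (dir_deriv b X) x"]
      parseval [of "dir_deriv a (dir_deriv b X) x" "dir_deriv a (dir_deriv b X) x"]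
    by (simp add: focal_second_order [OF assms(1-4)] sum_subtractf power2_eq_square cong: sum.cong_simp)
qed

text \<open>The map \<open>L\<close> is the differential of \<open>\<phi>\<close> at \<open>p\<close>. It carries a tangent frame \<open>B\<close> at \<open>p\<close> to one at
  \<open>\<phi> p\<close>. In \<open>gauss_split\<close> for \<open>X\<close> and for \<open>Y = \<phi> \<circ> X\<close> the left sides agree by \<open>theorema_egregium\<close> and
  the tangential parts by \<open>isometric_second_inner_first\<close>, hence the extrinsic parts agree. Summing
  over the frame gives the Ricci forms.\<close>

proposition ricci_form_isometry_invariant:
  assumes "\<phi> \<in> riemannian_isometries (focal_M1 m P)" "p \<in> focal_M1 m P" "m \<noteq> 0"
  obtains L where "\<And>a. tangent p a \<Longrightarrow> tangent (\<phi> p) (L a)"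
    "\<And>a. tangent p a \<Longrightarrow> L a \<bullet> L a = a \<bullet> a"
    "\<And>a. tangent p a \<Longrightarrow> ricci_form (\<phi> p) (L a) = ricci_form p a"
proof -
  let ?M = "focal_M1 m P"
  obtain V X where V: "open V" "p \<in> V" "Cinf_on V X" "X ` V \<subseteq> ?M" "X p = p"
    and X_tan: "\<And>a. tangent p a \<Longrightarrow> dir_deriv a X p = a"
    using local_retraction [OF assms(2)] by blast
  obtain W g where W: "open W" "p \<in> W" "Cinf_on W g" "\<And>x. x \<in> W \<inter> ?M \<Longrightarrow> g x = \<phi> x"
    using assms(1,2) by (auto simp: riemannian_isometries_def smooth_map_on_def)
  have maps: "\<phi> x \<in> ?M" if "x \<in> ?M" for x
    using assms(1) that by (auto simp: riemannian_isometries_def bij_betw_def)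
  define U where "U = V \<inter> X -` W"
  \<comment> \<open>\<open>Y\<close> is \<open>\<phi> \<circ> X\<close>, written with a smooth extension \<open>g\<close> of \<open>\<phi>\<close> so that it is visibly smooth.\<close>
  define Y where "Y = (\<lambda>x. g (X x))"
  have "open U"
    unfolding U_def by (rule continuous_open_preimage [OF Cinf_on_continuous [OF V(3)] V(1) W(1)])
  have "p \<in> U"
    using V W by (simp add: U_def)
  have X: "Cinf_on U X" "X ` U \<subseteq> ?M"
    using Cinf_on_subset [OF V(1) \<open>open U\<close> _ V(3)] V(4) by (auto simp: U_def)
  have "Cinf_on U Y"
    unfolding Y_def by (rule Cinf_on_compose [OF \<open>open U\<close> W(1) _ X(1) W(3)]) (auto simp: U_def)
  have Y_eq: "Y x = \<phi> (X x)" if "x \<in> U" for x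
    using that X(2) W(4) by (auto simp: Y_def U_def)
  then have Y_in: "Y ` U \<subseteq> ?M"
    using X(2) maps by auto
  have Y_p: "Y p = \<phi> p"
    using Y_eq [OF \<open>p \<in> U\<close>] V(5) by simp
  have metric: "dir_deriv a X x \<bullet> dir_deriv b X x = dir_deriv a Y x \<bullet> dir_deriv b Y x"
    if "x \<in> U" for a b x
    by (rule riemannian_isometry_pullback [OF assms(1) \<open>open U\<close> X \<open>Cinf_on U Y\<close> Y_eq that])
  define L where "L = (\<lambda>a. dir_deriv a Y p)"
  have L_eq: "dir_deriv a Y p = L a" for a
    by (simp add: L_def)
  have L_inner: "L a \<bullet> L b = a \<bullet> b" if "tangent p a" "tangent p b" for a b
    using metric [OF \<open>p \<in> U\<close>, of a b] that by (simp add: L_def X_tan)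
  have L_tan: "tangent (\<phi> p) (L a)" for a
    using focal_second_order(1) [OF \<open>open U\<close> \<open>Cinf_on U Y\<close> Y_in \<open>p \<in> U\<close>] by (simp add: L_def Y_p)
  obtain B where B: "tangent_frame p B"
    using tangent_frame_exists [OF assms(2)] .
  have B_tan: "tangent p e" if "e \<in> B" for e
    using B that by (simp add: tangent_frame_def)
  have L_inj: "inj_on L B"
  proof (rule inj_onI, rule ccontr)
    fix e f assume ef: "e \<in> B" "f \<in> B" "L e = L f" "e \<noteq> f"
    then have "e \<bullet> e = 0"
      using L_inner [of e e] L_inner [of e f] B_tan B by (auto simp: tangent_frame_def pairwise_def orthogonal_def)
    moreover have "norm e = 1"
      using B ef by (simp add: tangent_frame_def)
    ultimately show False
      by simp
  qed
  have LB: "tangent_frame (\<phi> p) (L ` B)"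
    using B L_tan L_inner [OF B_tan B_tan]
    by (auto simp: tangent_frame_def card_image [OF L_inj] pairwise_def orthogonal_def norm_eq_1)
  have key: "(\<Sum>\<alpha>\<le>m. ((P \<alpha> *v a) \<bullet> a) * ((P \<alpha> *v b) \<bullet> b) - ((P \<alpha> *v a) \<bullet> b)\<^sup>2)
      = (\<Sum>\<alpha>\<le>m. ((P \<alpha> *v L a) \<bullet> L a) * ((P \<alpha> *v L b) \<bullet> L b) - ((P \<alpha> *v L a) \<bullet> L b)\<^sup>2)"
    if "tangent p a" "tangent p b" for a b
  proof -
    have tangential: "dir_deriv c (dir_deriv d X) p \<bullet> e = dir_deriv c (dir_deriv d Y) p \<bullet> L e"
      if "e \<in> B" for c d e
      using isometric_second_inner_first [OF \<open>open U\<close> X(1) \<open>Cinf_on U Y\<close> metric \<open>p \<in> U\<close>, of c d e]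
      by (simp add: L_def X_tan B_tan that)
    have "(\<Sum>e\<in>L ` B. (dir_deriv a (dir_deriv a Y) p \<bullet> e) * (dir_deriv b (dir_deriv b Y) p \<bullet> e)
          - (dir_deriv a (dir_deriv b Y) p \<bullet> e)\<^sup>2)
      = (\<Sum>e\<in>B. (dir_deriv a (dir_deriv a X) p \<bullet> e) * (dir_deriv b (dir_deriv b X) p \<bullet> e)
          - (dir_deriv a (dir_deriv b X) p \<bullet> e)\<^sup>2)"
      by (simp add: sum.reindex [OF L_inj] tangential)
    moreover have "tangent_frame (X p) B" "tangent_frame (Y p) (L ` B)"
      using B LB by (simp_all add: V(5) Y_p)
    ultimately show ?thesis
      using gauss_split [OF \<open>open U\<close> X \<open>p \<in> U\<close>, of B a b]
        gauss_split [OF \<open>open U\<close> \<open>Cinf_on U Y\<close> Y_in \<open>p \<in> U\<close>, of "L ` B" a b]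
        theorema_egregium [OF \<open>open U\<close> X(1) \<open>Cinf_on U Y\<close> metric \<open>p \<in> U\<close>, of a b]
      by (simp add: X_tan that L_inner L_eq)
  qed
  have "ricci_form (\<phi> p) (L a) = ricci_form p a" if "tangent p a" for a
    using ricci_form_eq [OF assms(2) B that assms(3)]
      ricci_form_eq [OF maps [OF assms(2)] LB L_tan [of a] assms(3)]
    by (simp add: sum.reindex [OF L_inj] key [OF that B_tan] L_inner [OF that that] cong: sum.cong_simp)
  with L_tan L_inner show thesis
    using that by blast
qed

end


section \<open>Two points of the focal submanifold with different Ricci forms\<close>

lemma bessel_inequality:
  fixes w :: "'i \<Rightarrow> 'a::real_inner"
  assumes "finite I" "\<And>i j. i \<in> I \<Longrightarrow> j \<in> I \<Longrightarrow> w i \<bullet> w j = (if i = j then 1 else 0)"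
  shows "(\<Sum>i\<in>I. (b \<bullet> w i)\<^sup>2) \<le> b \<bullet> b"
proof -
  let ?s = "\<Sum>i\<in>I. (b \<bullet> w i) *\<^sub>R w i"
  have 1: "?s \<bullet> w j = b \<bullet> w j" if "j \<in> I" for j
  proof -
    have "?s \<bullet> w j = (\<Sum>i\<in>I. if i = j then b \<bullet> w j else 0)"
      unfolding inner_sum_left by (rule sum.cong) (use that assms(2) in auto)
    then show ?thesis
      using that assms(1) by simp
  qed
  have 2: "b \<bullet> ?s = (\<Sum>i\<in>I. (b \<bullet> w i)\<^sup>2)"
    by (simp add: inner_sum_right power2_eq_square)
  have 3: "?s \<bullet> ?s = (\<Sum>i\<in>I. (b \<bullet> w i)\<^sup>2)"
    unfolding inner_sum_right [of ?s] by (rule sum.cong) (simp_all add: 1 power2_eq_square)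
  have "0 \<le> (b - ?s) \<bullet> (b - ?s)"
    by simp
  also have "\<dots> = b \<bullet> b - 2 * (b \<bullet> ?s) + ?s \<bullet> ?s"
    by (simp add: inner_diff_left inner_diff_right inner_commute [of ?s b])
  finally show ?thesis
    by (simp add: 2 3)
qed

locale clifford3 = clifford 3 P for P :: "nat \<Rightarrow> real ^ 'n ^ 'n"
begin

lemma P_linear [simp]:
  "P \<alpha> *v (- x) = - (P \<alpha> *v x)"
  "P \<alpha> *v (x + y) = P \<alpha> *v x + P \<alpha> *v y"
  "P \<alpha> *v (x - y) = P \<alpha> *v x - P \<alpha> *v y"
  "P \<alpha> *v (c *\<^sub>R x) = c *\<^sub>R (P \<alpha> *v x)"
  by (simp_all add: linear_neg linear_add linear_diff linear_cmul)

text \<open>As a rewrite rule this sorts words in the \<open>P\<^sub>\<alpha>\<close>. Together with \<open>P_P\<close> and \<open>P_adjoint\<close> it reduces every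
  inner product of two words applied to \<open>x\<close> to \<open>\<plusminus> x \<bullet> w\<close> with \<open>w\<close> a sorted word without
  repetitions.\<close>

lemma P_sort [simp]: "\<beta> < \<alpha> \<Longrightarrow> \<alpha> \<le> 3 \<Longrightarrow> P \<alpha> *v (P \<beta> *v x) = - (P \<beta> *v (P \<alpha> *v x))"
  by (rule P_swap) auto

definition Q :: "real ^ 'n \<Rightarrow> real ^ 'n"
  where "Q x = P 0 *v (P 1 *v (P 2 *v (P 3 *v x)))"

lemma Q_linear: "Q (- x) = - Q x" "Q (x + y) = Q x + Q y" "Q (x - y) = Q x - Q y" "Q (c *\<^sub>R x) = c *\<^sub>R Q x"
  by (simp_all add: Q_def)

lemma Q_Q: "Q (Q x) = x"
  by (simp add: Q_def)

lemma Q_adjoint: "Q x \<bullet> y = x \<bullet> Q y"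
  by (simp add: Q_def P_adjoint)

lemma le_3_cases: "\<alpha> \<le> 3 \<Longrightarrow> \<alpha> = 0 \<or> \<alpha> = Suc 0 \<or> \<alpha> = 2 \<or> \<alpha> = (3::nat)"
  by linarith

lemma Q_anticommute: "\<alpha> \<le> 3 \<Longrightarrow> Q (P \<alpha> *v x) = - (P \<alpha> *v Q x)"
  by (drule le_3_cases) (auto simp: Q_def)

lemma atMost_3: "{..3::nat} = {0, 1, 2, 3}"
  by auto

text \<open>Sorted words of length two and three are skew-adjoint, so they contribute nothing. For points of
  \<open>M\<^sub>1\<close> only the empty word and the word \<open>Q\<close> of length four remain.\<close>

lemma word2_zero: "\<alpha> < \<beta> \<Longrightarrow> \<beta> \<le> 3 \<Longrightarrow> x \<bullet> (P \<alpha> *v (P \<beta> *v x)) = 0"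
  using P_inner_P [of \<alpha> \<beta> x] by (simp add: P_adjoint)

lemma word3_zero:
  assumes "\<alpha> < \<beta>" "\<beta> < \<gamma>" "\<gamma> \<le> 3"
  shows "x \<bullet> (P \<alpha> *v (P \<beta> *v (P \<gamma> *v x))) = 0"
proof -
  have le: "\<alpha> \<le> 3" "\<beta> \<le> 3" "\<alpha> < \<gamma>"
    using assms by auto
  have "x \<bullet> (P \<alpha> *v (P \<beta> *v (P \<gamma> *v x))) = (P \<gamma> *v (P \<beta> *v (P \<alpha> *v x))) \<bullet> x"
    by (simp only: P_adjoint le assms)
  also have "P \<gamma> *v (P \<beta> *v (P \<alpha> *v x)) = - (P \<alpha> *v (P \<beta> *v (P \<gamma> *v x)))"
    using assms le by simp
  finally show ?thesis
    by (simp add: inner_commute)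
qed

lemma ricci_form_expand: "ricci_form x b = (\<Sum>\<alpha>\<le>3. \<Sum>\<beta>\<le>3. (b \<bullet> (P \<alpha> *v (P \<beta> *v x)))\<^sup>2)"
  unfolding ricci_form_def by (intro sum.cong refl) (simp add: P_adjoint)

text \<open>If \<open>x \<bullet> Q x = 0\<close>, the six vectors \<open>P\<^sub>\<alpha> P\<^sub>\<beta> x\<close> with \<open>\<alpha> < \<beta>\<close> are orthonormal, and every square
  occurs twice in the form.\<close>

lemma ricci_form_le:
  assumes "x \<in> focal_M1 3 P" "x \<bullet> Q x = 0" "tangent x b"
  shows "ricci_form x b \<le> 2 * (b \<bullet> b)"
proof -
  let ?I = "{(0, 1), (0, 2), (0, 3), (1, 2), (1, 3), (2, 3)} :: (nat \<times> nat) set"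
  let ?w = "\<lambda>(\<alpha>, \<beta>). P \<alpha> *v (P \<beta> *v x)"
  have t: "x \<bullet> (P 0 *v (P (Suc 0) *v (P 2 *v (P 3 *v x)))) = 0"
    using assms(2) by (simp add: Q_def)
  have "(\<Sum>i\<in>?I. (b \<bullet> ?w i)\<^sup>2) \<le> b \<bullet> b"
  proof (rule bessel_inequality)
    show "?w i \<bullet> ?w j = (if i = j then 1 else 0)" if "i \<in> ?I" "j \<in> ?I" for i j
      using that focal_unit [OF assms(1)]
      by (elim insertE emptyE; hypsubst; simp add: P_adjoint word2_zero t)
  qed simp
  moreover have "ricci_form x b = 2 * (\<Sum>i\<in>?I. (b \<bullet> ?w i)\<^sup>2)"
    using assms(3) by (simp add: ricci_form_expand atMost_3 tangent_def)
  ultimately show ?thesis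
    by simp
qed

text \<open>If \<open>Q x = x\<close>, then \<open>P\<^sub>2 P\<^sub>3 x = - P\<^sub>0 P\<^sub>1 x\<close>, so four terms of the form equal \<open>1\<close> at this \<open>a\<close>.\<close>

lemma ricci_form_fixed:
  assumes "x \<in> focal_M1 3 P" "Q x = x"
  defines "a \<equiv> P 0 *v (P 1 *v x)"
  shows "tangent x a" "a \<bullet> a = 1" "ricci_form x a = 4"
proof -
  have h: "x \<bullet> (P \<alpha> *v x) = 0" if "\<alpha> \<le> 3" for \<alpha>
    using focal_height [OF assms(1) that] by (simp add: inner_commute)
  have t: "x \<bullet> (P 0 *v (P (Suc 0) *v (P 2 *v (P 3 *v x)))) = 1"
    using assms(2) focal_unit [OF assms(1)] by (simp add: Q_def)
  show "tangent x a"
    unfolding tangent_def a_def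
    by (auto dest!: le_3_cases simp: P_adjoint word2_zero word3_zero h)
  show "a \<bullet> a = 1"
    using focal_unit [OF assms(1)] by (simp add: a_def P_isometry)
  show "ricci_form x a = 4"
    using focal_unit [OF assms(1)]
    by (simp add: ricci_form_expand atMost_3 a_def P_adjoint word2_zero t)
qed

text \<open>\<open>Q\<close> is orthogonal and anticommutes with \<open>P\<^sub>\<alpha>\<close>, so \<open>P\<^sub>\<alpha>\<close> interchanges the eigenspaces of \<open>Q\<close>, which are
  orthogonal.\<close>

lemma eigenvector_in_focal:
  assumes "Q x = x \<or> Q x = - x" "\<alpha> \<le> 3"
  shows "x \<bullet> (P \<alpha> *v x) = 0"
proof -
  have "x \<bullet> (P \<alpha> *v x) = Q x \<bullet> (P \<alpha> *v Q x)"
    using assms(1) by auto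
  also have "\<dots> = - (Q x \<bullet> Q (P \<alpha> *v x))"
    by (simp add: Q_anticommute assms(2))
  also have "\<dots> = - (x \<bullet> (P \<alpha> *v x))"
    by (simp only: Q_adjoint Q_Q)
  finally show ?thesis
    by simp
qed

lemma fixed_point_exists:
  obtains p where "p \<in> focal_M1 3 P" "Q p = p"
proof -
  obtain v :: "real ^ 'n" where "v \<noteq> 0"
    using nonzero_Basis SOME_Basis by blast
  obtain u where u: "u \<noteq> 0" "Q u = u"
  proof (cases "v + Q v = 0")
    case False
    then show thesis
      using that [of "v + Q v"] by (simp add: Q_linear Q_Q add.commute)
  next
    case True
    then have "Q v = - v"
      by (simp add: eq_neg_iff_add_eq_0 add.commute)
    then have "Q (P 0 *v v) = P 0 *v v"
      by (simp add: Q_anticommute)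
    moreover have "P 0 *v v \<noteq> 0"
      using P_P [of 0 v] \<open>v \<noteq> 0\<close> by force
    ultimately show thesis
      using that by blast
  qed
  define p where "p = (1 / norm u) *\<^sub>R u"
  have "Q p = p"
    by (simp add: p_def Q_linear u)
  moreover have "p \<in> focal_M1 3 P"
    using u eigenvector_in_focal [OF disjI1 [OF \<open>Q p = p\<close>]]
    by (simp add: focal_M1_eq inner_commute) (simp add: p_def)
  ultimately show thesis
    using that by blast
qed

text \<open>Let \<open>p\<close> and \<open>e\<close> be unit eigenvectors of \<open>Q\<close> for the eigenvalues \<open>1\<close> and \<open>-1\<close>. Then \<open>(p + e) / \<surd>2\<close>
  is a unit vector on which the form of \<open>Q\<close> vanishes, and it lies in \<open>M\<^sub>1\<close> if \<open>e\<close> is orthogonal to all \<open>P\<^sub>\<alpha> p\<close>.\<close>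

lemma null_point_exists:
  assumes "CARD('n) > 8"
  obtains q where "q \<in> focal_M1 3 P" "q \<bullet> Q q = 0"
proof -
  obtain p where p: "p \<in> focal_M1 3 P" "Q p = p"
    using fixed_point_exists .
  \<comment> \<open>A vector \<open>w\<close> orthogonal to these eight has both \<open>w\<close> and \<open>P\<^sub>0 w\<close> orthogonal to all \<open>P\<^sub>\<alpha> p\<close>. The
      first yields the eigenvector \<open>w - Q w\<close>, unless it is zero; then \<open>P\<^sub>0 w\<close> is an eigenvector.\<close>
  let ?S = "(\<lambda>\<alpha>. P \<alpha> *v p) ` {..3} \<union> (\<lambda>\<alpha>. P 0 *v (P \<alpha> *v p)) ` {..3}"
  have "dim ?S \<le> card ?S"
    by (intro dim_le_card') simp
  also have "\<dots> \<le> card ((\<lambda>\<alpha>. P \<alpha> *v p) ` {..3}) + card ((\<lambda>\<alpha>. P 0 *v (P \<alpha> *v p)) ` {..3})"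
    by (rule card_Un_le)
  also have "\<dots> \<le> 4 + 4"
    using card_image_le [of "{..3::nat}" "\<lambda>\<alpha>. P \<alpha> *v p"]
      card_image_le [of "{..3::nat}" "\<lambda>\<alpha>. P 0 *v (P \<alpha> *v p)"]
    by (intro add_mono) simp_all
  finally have "dim ?S < DIM(real ^ 'n)"
    using assms by simp
  then obtain w where w: "w \<noteq> 0" "\<And>y. y \<in> span ?S \<Longrightarrow> orthogonal w y"
    by (rule orthogonal_to_subspace_exists) blast
  have w1: "w \<bullet> (P \<alpha> *v p) = 0" and w2: "(P 0 *v w) \<bullet> (P \<alpha> *v p) = 0" if "\<alpha> \<le> 3" for \<alpha>
    using w(2) [OF span_base, of "P \<alpha> *v p"] w(2) [OF span_base, of "P 0 *v (P \<alpha> *v p)"] that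
    by (auto simp: orthogonal_def P_adjoint [of 0])
  obtain u where u: "u \<noteq> 0" "Q u = - u" "\<And>\<alpha>. \<alpha> \<le> 3 \<Longrightarrow> u \<bullet> (P \<alpha> *v p) = 0"
  proof (cases "Q w = w")
    case True
    have "P 0 *v w \<noteq> 0"
      using P_P [of 0 w] w(1) by force
    then show thesis
      using that [of "P 0 *v w"] w2 True by (simp add: Q_anticommute)
  next
    case False
    have "(w - Q w) \<bullet> (P \<alpha> *v p) = 0" if "\<alpha> \<le> 3" for \<alpha>
      using w1 that p(2) by (simp add: inner_diff_left Q_adjoint Q_anticommute)
    then show thesis
      using that [of "w - Q w"] False by (simp add: Q_linear Q_Q)
  qed
  define e where "e = (1 / norm u) *\<^sub>R u"
  have e: "e \<bullet> e = 1" "Q e = - e" "\<And>\<alpha>. \<alpha> \<le> 3 \<Longrightarrow> e \<bullet> (P \<alpha> *v p) = 0"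
    using u by (simp_all add: e_def Q_linear dot_square_norm power2_eq_square)
  have pe: "p \<bullet> e = 0"
    using Q_adjoint [of p e] by (simp add: p e)
  have pp: "p \<bullet> p = 1"
    by (rule focal_unit [OF p(1)])
  define q where "q = (1 / sqrt 2) *\<^sub>R (p + e)"
  have scale: "q \<bullet> (c *\<^sub>R y) = 0" if "(p + e) \<bullet> y = 0" for c y
    using that by (simp add: q_def)
  have "q \<bullet> q = 1"
    using pp e(1) pe by (simp add: q_def inner_add_left inner_add_right inner_commute [of e p])
  moreover have "q \<bullet> (P \<alpha> *v q) = 0" if "\<alpha> \<le> 3" for \<alpha>
  proof -
    have "p \<bullet> (P \<alpha> *v e) = 0"
      using e(3) [OF that] P_adjoint [OF that, of p e] by (simp add: inner_commute)
    then have "(p + e) \<bullet> (P \<alpha> *v (p + e)) = 0"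
      using e(2,3) p(2) that eigenvector_in_focal [of p \<alpha>] eigenvector_in_focal [of e \<alpha>]
      by (simp add: inner_add_left inner_add_right)
    from scale [OF this, of "1 / sqrt 2"] show ?thesis
      by (simp add: q_def)
  qed
  moreover have "q \<bullet> Q q = 0"
  proof -
    have "(p + e) \<bullet> Q (p + e) = 0"
      by (simp add: Q_linear p e inner_add_left inner_diff_right pe pp inner_commute [of e p])
    from scale [OF this, of "1 / sqrt 2"] show ?thesis
      by (simp add: q_def Q_linear)
  qed
  ultimately show thesis
    using that [of q] by (simp add: focal_M1_eq norm_eq_1 inner_commute)
qed

end

theorem proposition1p2:
  fixes P :: "nat \<Rightarrow> real ^ 'n ^ 'n" and k l m :: nat
  assumes "k \<ge> 1"
    and "ot_fkm_type l m P"
    and "ot_fkm_multiplicities l m = (3, 4 * k)"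
  shows "\<not> intrinsically_homogeneous (focal_M1 m P)"
proof
  assume hom: "intrinsically_homogeneous (focal_M1 m P)"
  have m: "m = 3" and card: "CARD('n) > 8"
    using assms by (auto simp: ot_fkm_type_def ot_fkm_multiplicities_def)
  interpret clifford3 P
    by unfold_locales (use assms(2) m in \<open>simp add: ot_fkm_type_def\<close>)
  obtain p where p: "p \<in> focal_M1 3 P" "Q p = p"
    using fixed_point_exists .
  obtain q where q: "q \<in> focal_M1 3 P" "q \<bullet> Q q = 0"
    using null_point_exists [OF card] .
  obtain \<phi> where \<phi>: "\<phi> \<in> riemannian_isometries (focal_M1 3 P)" "\<phi> p = q"
    using hom p(1) q(1) m by (auto simp: intrinsically_homogeneous_def)
  let ?a = "P 0 *v (P 1 *v p)"
  obtain L where L: "\<And>a. tangent p a \<Longrightarrow> tangent q (L a)" "\<And>a. tangent p a \<Longrightarrow> L a \<bullet> L a = a \<bullet> a"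
    "\<And>a. tangent p a \<Longrightarrow> ricci_form q (L a) = ricci_form p a"
    using ricci_form_isometry_invariant [OF \<phi>(1) p(1)] \<phi>(2) by auto
  note a = ricci_form_fixed [OF p]
  have "4 = ricci_form q (L ?a)"
    using L(3) a(1,3) by simp
  also have "\<dots> \<le> 2 * (L ?a \<bullet> L ?a)"
    by (rule ricci_form_le [OF q L(1) [OF a(1)]])
  also have "\<dots> = 2"
    using L(2) [OF a(1)] a(2) by simp
  finally show False
    by simp
qed

end
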